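(* Let $\mathcal{X}$ be a metric measure space. (a) If $\mathcal{X}\le a\mathcal{X}$ for some $a\ne1$, then $a>1$ and $\mathcal{X}=\mathop{\boxplus}_{k=1}^{\infty}a^{-k}\mathcal{Z}$, where $\mathcal{Z}$ is defined by the requirement that $a\mathcal{X}=\mathcal{X}\boxplus\mathcal{Z}$. (b) If $(a\mathcal{X})\boxplus(b\mathcal{X})=c\mathcal{X}$ for some $a,b,c>0$, then $\mathcal{X}=\mathcal{E}$.
   Context: A metric measure space is a triple $\mathcal{X}=(X,r_X,\mu_X)$ where $(X,r_X)$ is a complete separable metric space and $\mu_X$ is a Borel probability measure on $X$ with full support. Two such spaces are equivalent if there is an isometry from one onto the other that maps the first probability measure to the second by push-forward. $\mathbb{M}$ denotes the set of equivalence classes, and a class is not distinguished from its representatives. $\mathcal{E}\in\mathbb{M}$ is the class of one-point spaces. For $\mathcal{Y},\mathcal{Z}\in\mathbb{M}$, $\mathcal{Y}\boxplus\mathcal{Z}:=(Y\times Z,\,r_Y\oplus r_Z,\,\mu_Y\otimes\mu_Z)$ with $(r_Y\oplus r_Z)((y',z'),(y'',z''))=r_Y(y',y'')+r_Z(z',z'')$; $(\mathbb{M},\boxplus)$ is a commutative semigroup with identity $\mathcal{E}$, and it is cancellative, so $\mathcal{Z}$ in (a) is unique. Scaling is defined for real $a>0$ by $a\mathcal{X}:=(X,a\,r_X,\mu_X)$. Partial order: $\mathcal{Y}\le\mathcal{Z}$ if $\mathcal{Z}=\mathcal{Y}\boxplus\mathcal{W}$ for some $\mathcal{W}\in\mathbb{M}$.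 $\mathbb{M}$ carries the topology of the Gromov–Prohorov metric $d_{\mathrm{GPr}}(\mathcal{X},\mathcal{Y}):=\inf d_{\mathrm{Pr}}^{(Z,r_Z)}(\mu_X\circ\phi_X^{-1},\mu_Y\circ\phi_Y^{-1})$, where the infimum is over all metric spaces $(Z,r_Z)$ and isometric embeddings $\phi_X:X\to Z$, $\phi_Y:Y\to Z$, and $d_{\mathrm{Pr}}^{(Z,r_Z)}(\mu_1,\mu_2):=\inf\{\epsilon>0:\mu_1(F)\le\mu_2(F^\epsilon)+\epsilon\text{ for all closed }F\}$, with $F^\epsilon:=\{z\in Z: r_Z(z,z')<\epsilon\text{ for some }z'\in F\}$, is the Prohorov metric. The infinite sum $\mathop{\boxplus}_{k=1}^{\infty}a^{-k}\mathcal{Z}$ denotes the limit in this metric, as $n\to\infty$, of the partial sums $a^{-1}\mathcal{Z}\boxplus a^{-2}\mathcal{Z}\boxplus\cdots\boxplus a^{-n}\mathcal{Z}$.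
   Formalization: In (a), the conclusion a > 1 is stated only for X different from the one-point class E, since E ≤ aE also holds for every 0 < a < 1; the series representation is still proved for X = E. *)

theory Defs
  imports "HOL-Probability.Probability"
begin

section \<open>Metric measure spaces\<close>

definition borel_metric :: "'a metric \<Rightarrow> 'a measure" where
  "borel_metric m = sigma (mspace m) {U. openin (mtopology_of m) U}"

text \<open>The underlying set of a metric measure space is the carrier \<^term>\<open>mspace m\<close> of its metric.\<close>

type_synonym 'a mm = "'a metric \<times> 'a measure"

definition mm_space :: "'a mm \<Rightarrow> bool" where
  "mm_space X \<longleftrightarrow> (case X of (m, \<mu>) \<Rightarrow>
     mcomplete_of m \<and> separable_space (mtopology_of m) \<and>
     sets \<mu> = sets (borel_metric m) \<and> prob_space \<mu> \<and>
     (\<forall>U. openin (mtopology_of m) U \<longrightarrow> U \<noteq> {} \<longrightarrow> 0 < measure \<mu> U))"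

definition mm_isometry :: "'a metric \<Rightarrow> 'b metric \<Rightarrow> ('a \<Rightarrow> 'b) \<Rightarrow> bool" where
  "mm_isometry m n \<phi> \<longleftrightarrow> bij_betw \<phi> (mspace m) (mspace n) \<and>
     (\<forall>x\<in>mspace m. \<forall>y\<in>mspace m. mdist n (\<phi> x) (\<phi> y) = mdist m x y)"

definition mm_equiv :: "'a mm \<Rightarrow> 'b mm \<Rightarrow> bool" where
  "mm_equiv X Y \<longleftrightarrow> (case (X, Y) of ((m, \<mu>), (n, \<nu>)) \<Rightarrow>
     \<exists>\<phi>. mm_isometry m n \<phi> \<and> distr \<mu> \<nu> \<phi> = \<nu>)"

definition mm_point :: "unit mm" where
  "mm_point = (metric (UNIV, \<lambda>_ _. 0), return (count_space UNIV) ())"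

definition sum_metric :: "'a metric \<Rightarrow> 'b metric \<Rightarrow> ('a \<times> 'b) metric" where
  "sum_metric m n = metric (mspace m \<times> mspace n,
     \<lambda>(y', z') (y'', z''). mdist m y' y'' + mdist n z' z'')"

definition mm_sum :: "'a mm \<Rightarrow> 'b mm \<Rightarrow> ('a \<times> 'b) mm" where
  "mm_sum Y Z = (sum_metric (fst Y) (fst Z), snd Y \<Otimes>\<^sub>M snd Z)"

definition scale_metric :: "real \<Rightarrow> 'a metric \<Rightarrow> 'a metric" where
  "scale_metric a m = metric (mspace m, \<lambda>x y. a * mdist m x y)"

definition mm_scale :: "real \<Rightarrow> 'a mm \<Rightarrow> 'a mm" where
  "mm_scale a X = (scale_metric a (fst X), snd X)"

section \<open>The Gromov-Prohorov metric\<close>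

definition nhd_of :: "'z metric \<Rightarrow> 'z set \<Rightarrow> real \<Rightarrow> 'z set" where
  "nhd_of m F \<epsilon> = {z \<in> mspace m. \<exists>z'\<in>F. mdist m z z' < \<epsilon>}"

definition prohorov :: "'z metric \<Rightarrow> 'z measure \<Rightarrow> 'z measure \<Rightarrow> real" where
  "prohorov m \<mu> \<nu> = Inf {\<epsilon>. 0 < \<epsilon> \<and>
     (\<forall>F. closedin (mtopology_of m) F \<longrightarrow> measure \<mu> F \<le> measure \<nu> (nhd_of m F \<epsilon>) + \<epsilon>)}"

definition isometric_embedding :: "'a metric \<Rightarrow> 'z metric \<Rightarrow> ('a \<Rightarrow> 'z) \<Rightarrow> bool" where
  "isometric_embedding m n \<phi> \<longleftrightarrow> \<phi> ` mspace m \<subseteq> mspace n \<and>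
     (\<forall>x\<in>mspace m. \<forall>y\<in>mspace m. mdist n (\<phi> x) (\<phi> y) = mdist m x y)"

definition embedded_prohorov ::
    "'a mm \<Rightarrow> 'b mm \<Rightarrow> 'z metric \<Rightarrow> ('a \<Rightarrow> 'z) \<Rightarrow> ('b \<Rightarrow> 'z) \<Rightarrow> real" where
  "embedded_prohorov X Y m \<phi> \<psi> = prohorov m
     (distr (snd X) (borel_metric m) \<phi>) (distr (snd Y) (borel_metric m) \<psi>)"

definition gromov_prohorov :: "'a mm \<Rightarrow> 'b mm \<Rightarrow> real" where
  "gromov_prohorov X Y = Inf {embedded_prohorov X Y m \<phi> \<psi> | (m :: real metric) \<phi> \<psi>.
     isometric_embedding (fst X) m \<phi> \<and> isometric_embedding (fst Y) m \<psi>}"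

section \<open>Basic facts\<close>

lemma Metric_space_sum:
  "Metric_space (mspace m \<times> mspace n) (\<lambda>(y', z') (y'', z''). mdist m y' y'' + mdist n z' z'')"
proof
  fix x y z assume "x \<in> mspace m \<times> mspace n" "y \<in> mspace m \<times> mspace n" "z \<in> mspace m \<times> mspace n"
  then show "(case x of (y', z') \<Rightarrow> \<lambda>(y'', z''). mdist m y' y'' + mdist n z' z'') z
    \<le> (case x of (y', z') \<Rightarrow> \<lambda>(y'', z''). mdist m y' y'' + mdist n z' z'') y
     + (case y of (y', z') \<Rightarrow> \<lambda>(y'', z''). mdist m y' y'' + mdist n z' z'') z"
    using mdist_triangle[of "fst x" m "fst y" "fst z"] mdist_triangle[of "snd x" n "snd y" "snd z"]
    by (auto simp: case_prod_unfold)
qed (auto simp: mdist_commute case_prod_unfold add_nonneg_eq_0_iff prod_eq_iff)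

lemma mspace_sum_metric [simp]: "mspace (sum_metric m n) = mspace m \<times> mspace n"
  and mdist_sum_metric [simp]:
    "mdist (sum_metric m n) = (\<lambda>(y', z') (y'', z''). mdist m y' y'' + mdist n z' z'')"
  unfolding sum_metric_def
  by (rule Metric_space.mspace_metric Metric_space.mdist_metric, rule Metric_space_sum)+

lemma Metric_space_scale:
  assumes a: "0 < a"
  shows "Metric_space (mspace m) (\<lambda>x y. a * mdist m x y)"
proof (rule Metric_space.intro)
  fix x y z assume "x \<in> mspace m" "y \<in> mspace m" "z \<in> mspace m"
  then show "a * mdist m x z \<le> a * mdist m x y + a * mdist m y z"
    using mult_left_mono[OF mdist_triangle[of x m y z], of a] a by (simp add: distrib_left)
next
  show "a * mdist m x y = a * mdist m y x" for x y by (simp only: mdist_commute)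
next
  show "0 \<le> a * mdist m x y" for x y using a by simp
next
  show "a * mdist m x y = 0 \<longleftrightarrow> x = y" if "x \<in> mspace m" "y \<in> mspace m" for x y
    using a that by simp
qed

lemma mspace_scale_metric [simp]: "0 < a \<Longrightarrow> mspace (scale_metric a m) = mspace m"
  and mdist_scale_metric [simp]: "0 < a \<Longrightarrow> mdist (scale_metric a m) = (\<lambda>x y. a * mdist m x y)"
  unfolding scale_metric_def
  by (rule Metric_space.mspace_metric Metric_space.mdist_metric, erule Metric_space_scale)+

lemma openin_mtopology_of:
  "openin (mtopology_of m) U \<longleftrightarrow>
     U \<subseteq> mspace m \<and> (\<forall>x\<in>U. \<exists>r>0. \<forall>y\<in>mspace m. mdist m x y < r \<longrightarrow> y \<in> U)"
proof -
  have "Metric_space.mball (mspace m) (mdist m) x r \<subseteq> U \<longleftrightarrow>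
      (\<forall>y\<in>mspace m. mdist m x y < r \<longrightarrow> y \<in> U)" if "x \<in> mspace m" for x r
    using that unfolding Metric_space.mball_def[OF Metric_space_mspace_mdist] by blast
  then show ?thesis
    unfolding mtopology_of_def Metric_space.openin_mtopology[OF Metric_space_mspace_mdist]
    by (metis subsetD)
qed

lemma space_borel_metric [simp]: "space (borel_metric m) = mspace m"
  unfolding borel_metric_def by (auto simp: space_measure_of_conv)

lemma sets_borel_metric:
  "sets (borel_metric m) = sigma_sets (mspace m) {U. openin (mtopology_of m) U}"
  unfolding borel_metric_def
  by (rule sets_measure_of) (auto simp: openin_mtopology_of)

lemma openin_borel_metric: "openin (mtopology_of m) U \<Longrightarrow> U \<in> sets (borel_metric m)"
  by (auto simp: sets_borel_metric)

lemma closedin_borel_metric: "closedin (mtopology_of m) F \<Longrightarrow> F \<in> sets (borel_metric m)"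
proof -
  assume F: "closedin (mtopology_of m) F"
  have "mspace m - F \<in> sets (borel_metric m)"
    by (rule openin_borel_metric) (use F in \<open>auto simp: closedin_def\<close>)
  then have "mspace m - (mspace m - F) \<in> sets (borel_metric m)"
    by (metis sets.compl_sets space_borel_metric)
  moreover have "mspace m - (mspace m - F) = F"
    using closedin_subset[OF F] by auto
  ultimately show ?thesis by simp
qed

lemma continuous_map_borel_metric:
  assumes "continuous_map (mtopology_of m) (mtopology_of n) f"
  shows "f \<in> borel_metric m \<rightarrow>\<^sub>M borel_metric n"
  unfolding borel_metric_def[of n]
proof (rule measurable_measure_of)
  show "f \<in> space (borel_metric m) \<rightarrow> mspace n"
    using continuous_map_funspace[OF assms] by simp
next
  fix U assume "U \<in> {U. openin (mtopology_of n) U}"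
  then have "openin (mtopology_of m) {x \<in> topspace (mtopology_of m). f x \<in> U}"
    using assms by (auto simp: continuous_map)
  moreover have "f -` U \<inter> space (borel_metric m) = {x \<in> topspace (mtopology_of m). f x \<in> U}"
    by auto
  ultimately show "f -` U \<inter> space (borel_metric m) \<in> sets (borel_metric m)"
    using openin_borel_metric by metis
qed (auto simp: openin_mtopology_of)

lemma isometric_embedding_continuous:
  assumes "isometric_embedding m n \<phi>"
  shows "continuous_map (mtopology_of m) (mtopology_of n) \<phi>"
proof -
  have d: "mdist n (\<phi> x) (\<phi> y) = mdist m x y" if "x \<in> mspace m" "y \<in> mspace m" for x y
    using assms that by (auto simp: isometric_embedding_def)
  have sub: "\<phi> x \<in> mspace n" if "x \<in> mspace m" for x
    using assms that by (auto simp: isometric_embedding_def)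
  show ?thesis
    unfolding continuous_map openin_mtopology_of topspace_mtopology_of
  proof (intro conjI allI impI ballI)
    fix U x assume U: "U \<subseteq> mspace n \<and> (\<forall>x\<in>U. \<exists>r>0. \<forall>y\<in>mspace n. mdist n x y < r \<longrightarrow> y \<in> U)"
      and x: "x \<in> {x \<in> mspace m. \<phi> x \<in> U}"
    then obtain r where "r > 0" "\<forall>y\<in>mspace n. mdist n (\<phi> x) y < r \<longrightarrow> y \<in> U" by auto
    with x show "\<exists>r>0. \<forall>y\<in>mspace m. mdist m x y < r \<longrightarrow> y \<in> {x \<in> mspace m. \<phi> x \<in> U}"
      using d sub by (intro exI[of _ r]) auto
  qed (use sub in auto)
qed

lemma isometric_embedding_measurable:
  "isometric_embedding m n \<phi> \<Longrightarrow> \<phi> \<in> borel_metric m \<rightarrow>\<^sub>M borel_metric n"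
  by (intro continuous_map_borel_metric isometric_embedding_continuous)

lemma mm_isometry_embedding: "mm_isometry m n \<phi> \<Longrightarrow> isometric_embedding m n \<phi>"
  by (auto simp: mm_isometry_def isometric_embedding_def bij_betw_def)

lemma mm_isometry_inv:
  assumes "mm_isometry m n \<phi>"
  shows "mm_isometry n m (inv_into (mspace m) \<phi>)"
proof -
  have b: "bij_betw \<phi> (mspace m) (mspace n)"
    and d: "\<And>x y. x \<in> mspace m \<Longrightarrow> y \<in> mspace m \<Longrightarrow> mdist n (\<phi> x) (\<phi> y) = mdist m x y"
    using assms by (auto simp: mm_isometry_def)
  have i: "inv_into (mspace m) \<phi> y \<in> mspace m" "\<phi> (inv_into (mspace m) \<phi> y) = y"
    if "y \<in> mspace n" for y
    using b that by (auto simp: bij_betw_def inv_into_into f_inv_into_f)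
  show ?thesis
    unfolding mm_isometry_def using bij_betw_inv_into[OF b] d i by metis
qed

lemma mm_isometry_comp:
  "mm_isometry m n \<phi> \<Longrightarrow> mm_isometry n k \<psi> \<Longrightarrow> mm_isometry m k (\<psi> \<circ> \<phi>)"
  unfolding mm_isometry_def using bij_betw_trans[of \<phi> "mspace m" "mspace n" \<psi> "mspace k"]
  by (metis bij_betwE comp_apply)

lemma mm_isometry_homeomorphic:
  assumes "mm_isometry m n \<phi>"
  shows "homeomorphic_map (mtopology_of m) (mtopology_of n) \<phi>"
proof -
  interpret Metric_space12 "mspace m" "mdist m" "mspace n" "mdist n"
    by (rule Metric_space12_mspace_mdist)
  show ?thesis
    using assms isometry_imp_homeomorphic_map[of \<phi>]
    by (auto simp: mm_isometry_def bij_betw_def mtopology_of_def)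
qed

lemma mm_isometry_mcomplete:
  assumes \<phi>: "mm_isometry m n \<phi>" and c: "mcomplete_of m"
  shows "mcomplete_of n"
proof -
  interpret Metric_space12 "mspace m" "mdist m" "mspace n" "mdist n"
    by (rule Metric_space12_mspace_mdist)
  define \<psi> where "\<psi> = inv_into (mspace m) \<phi>"
  have \<psi>: "mm_isometry n m \<psi>" unfolding \<psi>_def by (rule mm_isometry_inv[OF \<phi>])
  have i: "\<psi> y \<in> mspace m" "\<phi> (\<psi> y) = y" if "y \<in> mspace n" for y
    using \<phi> that by (auto simp: mm_isometry_def \<psi>_def bij_betw_def inv_into_into f_inv_into_f)
  have "\<exists>x. limitin M2.mtopology \<sigma> x sequentially" if s: "M2.MCauchy \<sigma>" for \<sigma>
  proof -
    have r: "range \<sigma> \<subseteq> mspace n" using s by (auto simp: M2.MCauchy_def)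
    have "M1.MCauchy (\<psi> \<circ> \<sigma>)"
      using s \<psi> r i unfolding M1.MCauchy_def M2.MCauchy_def mm_isometry_def
      by (auto simp: image_subset_iff)
    then obtain x where "limitin M1.mtopology (\<psi> \<circ> \<sigma>) x sequentially"
      using c by (auto simp: mcomplete_of_def M1.mcomplete_def)
    then have "limitin M2.mtopology (\<phi> \<circ> (\<psi> \<circ> \<sigma>)) (\<phi> x) sequentially"
      using isometric_embedding_continuous[OF mm_isometry_embedding[OF \<phi>]]
      by (intro continuous_map_limit) (auto simp: mtopology_of_def)
    moreover have "\<phi> \<circ> (\<psi> \<circ> \<sigma>) = \<sigma>" using r i by (auto simp: fun_eq_iff)
    ultimately show ?thesis by metis
  qed
  then show ?thesis by (auto simp: mcomplete_of_def M2.mcomplete_def)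
qed

lemma mm_space_transport:
  assumes X: "mm_space (m, \<mu>)" and \<phi>: "mm_isometry m n \<phi>"
  shows "mm_space (n, distr \<mu> (borel_metric n) \<phi>)"
    and "mm_equiv (m, \<mu>) (n, distr \<mu> (borel_metric n) \<phi>)"
proof -
  have sm: "sets \<mu> = sets (borel_metric m)" using X by (auto simp: mm_space_def)
  have meas: "\<phi> \<in> \<mu> \<rightarrow>\<^sub>M borel_metric n"
    using isometric_embedding_measurable[OF mm_isometry_embedding[OF \<phi>]]
    unfolding measurable_cong_sets[OF sm refl] .
  have sp: "space \<mu> = mspace m" using sets_eq_imp_space_eq[OF sm] by simp
  have b: "bij_betw \<phi> (mspace m) (mspace n)" using \<phi> by (auto simp: mm_isometry_def)
  show "mm_space (n, distr \<mu> (borel_metric n) \<phi>)"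
    unfolding mm_space_def case_prod_conv
  proof (intro conjI allI impI)
    show "mcomplete_of n" using mm_isometry_mcomplete[OF \<phi>] X by (auto simp: mm_space_def)
    show "separable_space (mtopology_of n)"
      using X homeomorphic_separable_space[OF homeomorphic_map_imp_homeomorphic_space[OF mm_isometry_homeomorphic[OF \<phi>]]]
      by (auto simp: mm_space_def)
    show "prob_space (distr \<mu> (borel_metric n) \<phi>)"
      using X meas by (intro prob_space.prob_space_distr) (auto simp: mm_space_def)
    fix U assume U: "openin (mtopology_of n) U" "U \<noteq> {}"
    have "openin (mtopology_of m) {x \<in> topspace (mtopology_of m). \<phi> x \<in> U}"
      using isometric_embedding_continuous[OF mm_isometry_embedding[OF \<phi>]] U
      by (auto simp: continuous_map)
    moreover have "{x \<in> topspace (mtopology_of m). \<phi> x \<in> U} \<noteq> {}"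
    proof -
      from U obtain y where "y \<in> U" by auto
      moreover have "y \<in> mspace n" using openin_subset[OF U(1)] \<open>y \<in> U\<close> by auto
      ultimately obtain x where "x \<in> mspace m" "\<phi> x = y"
        using b by (metis bij_betw_imp_surj_on imageE)
      with \<open>y \<in> U\<close> show ?thesis by auto
    qed
    ultimately have "0 < measure \<mu> {x \<in> topspace (mtopology_of m). \<phi> x \<in> U}"
      using X by (auto simp: mm_space_def)
    also have "{x \<in> topspace (mtopology_of m). \<phi> x \<in> U} = \<phi> -` U \<inter> space \<mu>"
      using sp by auto
    finally show "0 < measure (distr \<mu> (borel_metric n) \<phi>) U"
      using meas openin_borel_metric[OF U(1)] by (simp add: measure_distr)
  qed simp
  show "mm_equiv (m, \<mu>) (n, distr \<mu> (borel_metric n) \<phi>)"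
    unfolding mm_equiv_def case_prod_conv
    by (rule exI[of _ \<phi>], rule conjI[OF \<phi>], rule distr_cong) simp_all
qed

lemma mm_space_sets: "mm_space X \<Longrightarrow> sets (snd X) = sets (borel_metric (fst X))"
  by (auto simp: mm_space_def)

lemma mm_space_space: "mm_space X \<Longrightarrow> space (snd X) = mspace (fst X)"
  using sets_eq_imp_space_eq[OF mm_space_sets] by fastforce

lemma mm_space_prob: "mm_space X \<Longrightarrow> prob_space (snd X)"
  by (auto simp: mm_space_def)

lemma mm_isometry_measurable:
  assumes "mm_space X" "mm_space Y" "isometric_embedding (fst X) (fst Y) \<phi>"
  shows "\<phi> \<in> snd X \<rightarrow>\<^sub>M snd Y"
  using isometric_embedding_measurable[OF assms(3)]
  unfolding measurable_cong_sets[OF mm_space_sets[OF assms(1)] mm_space_sets[OF assms(2)]] .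

lemma mm_equiv_refl: "mm_equiv X X"
  unfolding mm_equiv_def
  by (auto split: prod.splits intro!: exI[of _ "\<lambda>x. x"] simp: mm_isometry_def bij_betw_def inj_on_def distr_id)

lemma mm_equiv_sym:
  assumes X: "mm_space X" and Y: "mm_space Y" and e: "mm_equiv X Y"
  shows "mm_equiv Y X"
proof -
  obtain \<phi> where \<phi>: "mm_isometry (fst X) (fst Y) \<phi>" "distr (snd X) (snd Y) \<phi> = snd Y"
    using e by (auto simp: mm_equiv_def split: prod.splits)
  define \<psi> where "\<psi> = inv_into (mspace (fst X)) \<phi>"
  have \<psi>: "mm_isometry (fst Y) (fst X) \<psi>" unfolding \<psi>_def by (rule mm_isometry_inv[OF \<phi>(1)])
  have m1: "\<phi> \<in> snd X \<rightarrow>\<^sub>M snd Y" using X Y \<phi> mm_isometry_embedding mm_isometry_measurable by metis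
  have m2: "\<psi> \<in> snd Y \<rightarrow>\<^sub>M snd X" using X Y \<psi> mm_isometry_embedding mm_isometry_measurable by metis
  have "distr (snd Y) (snd X) \<psi> = distr (distr (snd X) (snd Y) \<phi>) (snd X) \<psi>" by (simp add: \<phi>)
  also have "\<dots> = distr (snd X) (snd X) (\<psi> \<circ> \<phi>)" by (rule distr_distr[OF m2 m1])
  also have "\<dots> = distr (snd X) (snd X) (\<lambda>x. x)"
    using \<phi>(1) by (intro distr_cong) (auto simp: mm_space_space[OF X] \<psi>_def mm_isometry_def bij_betw_def)
  also have "\<dots> = snd X" by (rule distr_id)
  finally show ?thesis using \<psi> by (auto simp: mm_equiv_def split: prod.splits)
qed

lemma mm_equiv_trans:
  assumes X: "mm_space X" and Y: "mm_space Y" and Z: "mm_space Z"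
    and e: "mm_equiv X Y" "mm_equiv Y Z"
  shows "mm_equiv X Z"
proof -
  obtain \<phi> where \<phi>: "mm_isometry (fst X) (fst Y) \<phi>" "distr (snd X) (snd Y) \<phi> = snd Y"
    using e by (auto simp: mm_equiv_def split: prod.splits)
  obtain \<psi> where \<psi>: "mm_isometry (fst Y) (fst Z) \<psi>" "distr (snd Y) (snd Z) \<psi> = snd Z"
    using e by (auto simp: mm_equiv_def split: prod.splits)
  have m1: "\<phi> \<in> snd X \<rightarrow>\<^sub>M snd Y" using X Y \<phi> mm_isometry_embedding mm_isometry_measurable by metis
  have m2: "\<psi> \<in> snd Y \<rightarrow>\<^sub>M snd Z" using Y Z \<psi> mm_isometry_embedding mm_isometry_measurable by metis
  have "distr (snd X) (snd Z) (\<psi> \<circ> \<phi>) = snd Z"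
    using distr_distr[OF m2 m1] \<phi> \<psi> by simp
  then show ?thesis using mm_isometry_comp[OF \<phi>(1) \<psi>(1)] by (auto simp: mm_equiv_def split: prod.splits)
qed

text \<open>Every separable metric space has at most the cardinality of the continuum, hence an isometric
  copy whose carrier is a set of reals.\<close>

lemma ex_isometric_copy:
  fixes m :: "'a metric" and f :: "'a \<Rightarrow> 'b"
  assumes f: "inj_on f (mspace m)"
  shows "\<exists>n :: 'b metric. mspace n = f ` mspace m \<and> mm_isometry m n f"
proof -
  define g where "g = inv_into (mspace m) f"
  have g: "g (f x) = x" if "x \<in> mspace m" for x
    using f that by (simp add: g_def)
  have M: "Metric_space (f ` mspace m) (\<lambda>u v. mdist m (g u) (g v))"
    by unfold_locales (auto simp: g mdist_commute mdist_triangle)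
  define n where "n = metric (f ` mspace m, \<lambda>u v. mdist m (g u) (g v))"
  have n: "mspace n = f ` mspace m" "mdist n = (\<lambda>u v. mdist m (g u) (g v))"
    using Metric_space.mspace_metric[OF M] Metric_space.mdist_metric[OF M] by (simp_all add: n_def)
  show ?thesis
    by (rule exI[of _ n]) (auto simp: n mm_isometry_def g f bij_betw_def)
qed

lemma separable_dense:
  assumes "separable_space (mtopology_of m)"
  obtains C where "countable C" "C \<subseteq> mspace m"
    "\<And>x r. x \<in> mspace m \<Longrightarrow> 0 < r \<Longrightarrow> \<exists>c\<in>C. mdist m x c < r"
proof -
  obtain C where C: "countable C" "C \<subseteq> mspace m" "mtopology_of m closure_of C = mspace m"
    using assms by (auto simp: separable_space_def)
  have "\<exists>c\<in>C. mdist m x c < r" if "x \<in> mspace m" "0 < r" for x r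
    using C(3) that
    unfolding mtopology_of_def Metric_space.metric_closure_of[OF Metric_space_mspace_mdist]
    by (force simp: Metric_space.mball_def[OF Metric_space_mspace_mdist])
  with C that show ?thesis by blast
qed

lemma separable_inj_real:
  assumes "separable_space (mtopology_of (m :: 'a metric))"
  shows "\<exists>f :: 'a \<Rightarrow> real. inj_on f (mspace m)"
proof (cases "mspace m = {}")
  case False
  obtain C where C: "countable C" "C \<subseteq> mspace m"
    and dense: "\<And>x r. x \<in> mspace m \<Longrightarrow> 0 < r \<Longrightarrow> \<exists>c\<in>C. mdist m x c < r"
    using separable_dense[OF assms] by metis
  have ne: "C \<noteq> {}" using False dense[of _ 1] by fastforce
  define s where "s = from_nat_into C"
  have s: "range s = C" using ne C by (simp add: s_def range_from_nat_into)
  define h where "h = (\<lambda>x. {prod_encode (k, j) |k j. mdist m x (s k) < 1 / real (Suc j)})"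
  have hi: "prod_encode (k, j) \<in> h x \<longleftrightarrow> mdist m x (s k) < 1 / real (Suc j)" for k j x
    by (auto simp: h_def)
  have "inj_on h (mspace m)"
  proof (rule inj_onI, rule ccontr)
    fix x y assume xy: "x \<in> mspace m" "y \<in> mspace m" "h x = h y" "x \<noteq> y"
    then have "mdist m x y > 0"
      by (metis less_eq_real_def mdist_nonneg mdist_zero)
    then obtain j where j: "1 / real (Suc j) < mdist m x y / 2"
      by (metis half_gt_zero inverse_eq_divide reals_Archimedean)
    obtain k where k: "mdist m x (s k) < 1 / real (Suc j)"
      using dense[OF xy(1), of "1 / real (Suc j)"] s by auto
    then have "mdist m y (s k) < 1 / real (Suc j)" using hi xy by blast
    moreover have "s k \<in> mspace m" using s C by auto
    ultimately have "mdist m x y < 1 / real (Suc j) + 1 / real (Suc j)"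
      using mdist_triangle[of x m "s k" y] xy k by (simp add: mdist_commute)
    with j show False by simp
  qed
  moreover obtain b :: "nat set \<Rightarrow> real" where "inj b"
    using nat_sets_eqpoll_reals by (auto simp: eqpoll_def bij_betw_def)
  ultimately have "inj_on (b \<circ> h) (mspace m)"
    by (meson comp_inj_on inj_on_subset subset_UNIV)
  then show ?thesis by blast
qed auto

lemma mm_real_copy:
  assumes "mm_space X"
  shows "\<exists>Y :: real mm. mm_space Y \<and> mm_equiv X Y"
proof -
  obtain m \<mu> where X: "X = (m, \<mu>)" by fastforce
  obtain f :: "'a \<Rightarrow> real" where "inj_on f (mspace m)"
    using separable_inj_real[of m] assms X by (auto simp: mm_space_def)
  then obtain n :: "real metric" where "mm_isometry m n f"
    using ex_isometric_copy by blast
  then show ?thesis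
    using mm_space_transport[of m \<mu> n f] assms X by blast
qed

lemma mm_space_point: "mm_space mm_point"
proof -
  have M: "Metric_space (UNIV :: unit set) (\<lambda>_ _. 0)" by (simp add: Metric_space_def)
  define p :: "unit metric" where "p = metric (UNIV, \<lambda>_ _. 0)"
  have p: "mspace p = UNIV" "mdist p = (\<lambda>_ _. 0)"
    unfolding p_def by (rule Metric_space.mspace_metric[OF M] Metric_space.mdist_metric[OF M])+
  have t: "openin (mtopology_of p) U" for U
    unfolding openin_mtopology_of p by (auto intro!: exI[of _ 1])
  have s: "sets (borel_metric p) = UNIV"
    using openin_borel_metric[OF t] by blast
  have "mm_space (p, return (count_space UNIV) ())"
    unfolding mm_space_def case_prod_conv
  proof (intro conjI allI impI)
    show "mcomplete_of p"
      unfolding mcomplete_of_def p Metric_space.mcomplete_def[OF M]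
        Metric_space.limit_metric_sequentially[OF M] by auto
    show "separable_space (mtopology_of p)"
      unfolding separable_space_def
      by (rule exI[of _ "topspace (mtopology_of p)"]) (simp only: closure_of_topspace, simp)
    show "prob_space (return (count_space UNIV) ())" by (rule prob_space_return) auto
    fix U :: "unit set" assume "U \<noteq> {}"
    then have "U = UNIV" by auto
    then show "0 < measure (return (count_space UNIV) ()) U"
      by (simp add: measure_return)
  qed (simp add: s)
  then show ?thesis by (simp add: mm_point_def p_def)
qed

lemma mtopology_of_scale [simp]: "0 < a \<Longrightarrow> mtopology_of (scale_metric a m) = mtopology_of m"
proof -
  assume a: "0 < a"
  have "(\<exists>r>0. \<forall>y\<in>mspace m. a * mdist m x y < r \<longrightarrow> y \<in> U) \<longleftrightarrow>
        (\<exists>r>0. \<forall>y\<in>mspace m. mdist m x y < r \<longrightarrow> y \<in> U)" for x U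
  proof
    assume "\<exists>r>0. \<forall>y\<in>mspace m. a * mdist m x y < r \<longrightarrow> y \<in> U"
    then obtain r where "r > 0" "\<forall>y\<in>mspace m. a * mdist m x y < r \<longrightarrow> y \<in> U" by blast
    with a show "\<exists>r>0. \<forall>y\<in>mspace m. mdist m x y < r \<longrightarrow> y \<in> U"
      by (intro exI[of _ "r / a"]) (auto simp: field_simps)
  next
    assume "\<exists>r>0. \<forall>y\<in>mspace m. mdist m x y < r \<longrightarrow> y \<in> U"
    then obtain r where "r > 0" "\<forall>y\<in>mspace m. mdist m x y < r \<longrightarrow> y \<in> U" by blast
    with a show "\<exists>r>0. \<forall>y\<in>mspace m. a * mdist m x y < r \<longrightarrow> y \<in> U"
      by (intro exI[of _ "a * r"]) auto
  qed
  then show ?thesis unfolding topology_eq openin_mtopology_of using a by simp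
qed

lemma mm_space_scale:
  assumes a: "0 < a" and X: "mm_space X"
  shows "mm_space (mm_scale a X)"
proof -
  obtain m \<mu> where Xm: "X = (m, \<mu>)" by fastforce
  interpret M1: Metric_space "mspace m" "mdist m" by auto
  interpret M2: Metric_space "mspace m" "\<lambda>x y. a * mdist m x y" by (rule Metric_space_scale[OF a])
  have top: "M2.mtopology = M1.mtopology"
    using mtopology_of_scale[OF a, of m] a by (simp add: mtopology_of_def)
  have C: "M1.MCauchy \<sigma>" if M2: "M2.MCauchy \<sigma>" for \<sigma>
    unfolding M1.MCauchy_def
  proof (intro conjI allI impI)
    fix \<epsilon> :: real assume "0 < \<epsilon>"
    then have "0 < a * \<epsilon>" using a by simp
    then obtain N where "\<And>n n'. N \<le> n \<Longrightarrow> N \<le> n' \<Longrightarrow> a * mdist m (\<sigma> n) (\<sigma> n') < a * \<epsilon>"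
      using M2 unfolding M2.MCauchy_def by blast
    then show "\<exists>N. \<forall>n n'. N \<le> n \<longrightarrow> N \<le> n' \<longrightarrow> mdist m (\<sigma> n) (\<sigma> n') < \<epsilon>"
      using a by (intro exI[of _ N]) auto
  qed (use M2 in \<open>auto simp: M2.MCauchy_def\<close>)
  have "mcomplete_of (scale_metric a m)"
    using X C a by (auto simp: Xm mm_space_def mcomplete_of_def M1.mcomplete_def M2.mcomplete_def top)
  moreover have "sets (borel_metric (scale_metric a m)) = sets (borel_metric m)"
    using a by (simp add: borel_metric_def)
  ultimately show ?thesis
    using X a by (auto simp: Xm mm_space_def mm_scale_def)
qed

lemma mm_equiv_scale:
  "0 < a \<Longrightarrow> mm_equiv X Y \<Longrightarrow> mm_equiv (mm_scale a X) (mm_scale a Y)"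
  by (auto simp: mm_equiv_def mm_scale_def mm_isometry_def split: prod.splits)

lemma mtopology_of_sum:
  "mtopology_of (sum_metric m n) = prod_topology (mtopology_of m) (mtopology_of n)"
proof -
  interpret Metric_space12 "mspace m" "mdist m" "mspace n" "mdist n"
    by (rule Metric_space12_mspace_mdist)
  have eq: "prod_topology (mtopology_of m) (mtopology_of n) = mtopology_of (prod_metric m n)"
    using mtopology_prod_metric by (simp add: mtopology_of_def)
  have le: "prod_dist (mdist m) (mdist n) x y \<le> mdist (sum_metric m n) x y"
    if "x \<in> mspace m \<times> mspace n" "y \<in> mspace m \<times> mspace n" for x y
    using that prod_metric_le_components by (auto simp: case_prod_unfold)
  have ge: "mdist (sum_metric m n) x y \<le> 2 * prod_dist (mdist m) (mdist n) x y" for x y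
    using component_le_prod_metric(1)[of "fst x" "fst y" "snd x" "snd y"]
      component_le_prod_metric(2)[of "snd x" "snd y" "fst x" "fst y"]
    by (auto simp: case_prod_unfold)
  have "(\<exists>r>0. \<forall>y\<in>mspace m \<times> mspace n. mdist (sum_metric m n) x y < r \<longrightarrow> y \<in> U) \<longleftrightarrow>
        (\<exists>r>0. \<forall>y\<in>mspace m \<times> mspace n. prod_dist (mdist m) (mdist n) x y < r \<longrightarrow> y \<in> U)"
    if x: "x \<in> mspace m \<times> mspace n" for x U
  proof
    assume "\<exists>r>0. \<forall>y\<in>mspace m \<times> mspace n. mdist (sum_metric m n) x y < r \<longrightarrow> y \<in> U"
    then obtain r where r: "r > 0" "\<And>y. y\<in>mspace m \<times> mspace n \<Longrightarrow> mdist (sum_metric m n) x y < r \<Longrightarrow> y \<in> U" by blast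
    show "\<exists>r>0. \<forall>y\<in>mspace m \<times> mspace n. prod_dist (mdist m) (mdist n) x y < r \<longrightarrow> y \<in> U"
    proof (intro exI[of _ "r / 2"] conjI ballI impI)
      fix y assume y: "y \<in> mspace m \<times> mspace n" "prod_dist (mdist m) (mdist n) x y < r / 2"
      then have "mdist (sum_metric m n) x y < r" using ge[of x y] by linarith
      with y r show "y \<in> U" by blast
    qed (use r in auto)
  next
    assume "\<exists>r>0. \<forall>y\<in>mspace m \<times> mspace n. prod_dist (mdist m) (mdist n) x y < r \<longrightarrow> y \<in> U"
    then obtain r where r: "r > 0" "\<And>y. y\<in>mspace m \<times> mspace n \<Longrightarrow> prod_dist (mdist m) (mdist n) x y < r \<Longrightarrow> y \<in> U" by blast
    show "\<exists>r>0. \<forall>y\<in>mspace m \<times> mspace n. mdist (sum_metric m n) x y < r \<longrightarrow> y \<in> U"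
    proof (intro exI[of _ r] conjI ballI impI)
      fix y assume y: "y \<in> mspace m \<times> mspace n" "mdist (sum_metric m n) x y < r"
      then have "prod_dist (mdist m) (mdist n) x y < r" using le[OF x y(1)] by linarith
      with y r show "y \<in> U" by blast
    qed (use r in auto)
  qed
  note * = this
  show ?thesis
    unfolding eq topology_eq openin_mtopology_of mspace_sum_metric mspace_prod_metric mdist_prod_metric
    by (intro allI conj_cong refl ball_cong) (rule *, blast)
qed

lemma mcomplete_of_sum:
  assumes "mcomplete_of m" "mcomplete_of n"
  shows "mcomplete_of (sum_metric m n)"
proof -
  interpret M1: Metric_space "mspace m" "mdist m" by auto
  interpret M2: Metric_space "mspace n" "mdist n" by auto
  interpret P: Metric_space "mspace m \<times> mspace n" "mdist (sum_metric m n)"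
    using Metric_space_mspace_mdist[of "sum_metric m n"] by simp
  have top: "P.mtopology = prod_topology M1.mtopology M2.mtopology"
    using mtopology_of_sum[of m n] by (simp add: mtopology_of_def)
  have "\<exists>x. limitin P.mtopology \<sigma> x sequentially" if s: "P.MCauchy \<sigma>" for \<sigma>
  proof -
    have r: "\<sigma> k \<in> mspace m \<times> mspace n" for k
      using s unfolding P.MCauchy_def by blast
    have b: "mdist m (fst x) (fst y) \<le> mdist (sum_metric m n) x y"
      "mdist n (snd x) (snd y) \<le> mdist (sum_metric m n) x y" for x y
      by (auto simp: case_prod_unfold)
    have r1: "range (fst \<circ> \<sigma>) \<subseteq> mspace m" and r2: "range (snd \<circ> \<sigma>) \<subseteq> mspace n"
      using r by (auto simp: mem_Times_iff)
    have "M1.MCauchy (fst \<circ> \<sigma>)" "M2.MCauchy (snd \<circ> \<sigma>)"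
      using s b r1 r2 unfolding P.MCauchy_def M1.MCauchy_def M2.MCauchy_def o_apply
      by (meson order.strict_trans1)+
    then obtain x y where "limitin M1.mtopology (fst \<circ> \<sigma>) x sequentially"
      "limitin M2.mtopology (snd \<circ> \<sigma>) y sequentially"
      using assms unfolding mcomplete_of_def M1.mcomplete_def M2.mcomplete_def by blast
    then show ?thesis unfolding top limitin_pairwise by (intro exI[of _ "(x, y)"]) simp
  qed
  then show ?thesis unfolding mcomplete_of_def mspace_sum_metric P.mcomplete_def by blast
qed

lemma separable_sum:
  assumes "separable_space (mtopology_of m)" "separable_space (mtopology_of n)"
  shows "separable_space (mtopology_of (sum_metric m n))"
proof -
  obtain C D where "countable C" "C \<subseteq> mspace m" "mtopology_of m closure_of C = mspace m"
     "countable D" "D \<subseteq> mspace n" "mtopology_of n closure_of D = mspace n"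
    using assms by (auto simp: separable_space_def)
  then show ?thesis
    unfolding separable_space_def mtopology_of_sum
    by (intro exI[of _ "C \<times> D"]) (auto simp: closure_of_Times)
qed

lemma openin_mball_of: "openin (mtopology_of m) (mball_of m x r)"
  by (simp add: mtopology_of_def mball_of_def Metric_space.openin_mball)

text \<open>By separability, the product of the Borel sigma-algebras is the Borel sigma-algebra of the
  sum metric.\<close>

lemma sets_borel_metric_sum:
  assumes "separable_space (mtopology_of m)" "separable_space (mtopology_of n)"
  shows "sets (borel_metric m \<Otimes>\<^sub>M borel_metric n) = sets (borel_metric (sum_metric m n))"
proof
  show "sets (borel_metric (sum_metric m n)) \<subseteq> sets (borel_metric m \<Otimes>\<^sub>M borel_metric n)"
    unfolding sets_borel_metric[of "sum_metric m n"]
  proof (rule sets.sigma_sets_subset'[OF subsetI])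
    fix U assume "U \<in> {U. openin (mtopology_of (sum_metric m n)) U}"
    then have U: "openin (mtopology_of (sum_metric m n)) U" by simp
    obtain C where C: "countable C" "C \<subseteq> mspace m"
      and Cd: "\<And>x r. x \<in> mspace m \<Longrightarrow> 0 < r \<Longrightarrow> \<exists>c\<in>C. mdist m x c < r"
      using separable_dense[OF assms(1)] by metis
    obtain D where D: "countable D" "D \<subseteq> mspace n"
      and Dd: "\<And>x r. x \<in> mspace n \<Longrightarrow> 0 < r \<Longrightarrow> \<exists>c\<in>D. mdist n x c < r"
      using separable_dense[OF assms(2)] by metis
    define B where "B = (\<lambda>(c, d, k). mball_of m c (1 / real (Suc k)) \<times> mball_of n d (1 / real (Suc k)))"
    define I where "I = {i \<in> C \<times> D \<times> UNIV. B i \<subseteq> U}"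
    have cI: "countable I"
      unfolding I_def using C D by (intro countable_Collect countable_SIGMA) auto
    have Bm: "B i \<in> sets (borel_metric m \<Otimes>\<^sub>M borel_metric n)" for i
      unfolding B_def by (auto split: prod.splits intro!: pair_measureI openin_borel_metric openin_mball_of)
    have "U \<subseteq> (\<Union>i\<in>I. B i)"
    proof
      fix z assume z: "z \<in> U"
      obtain x y where xy: "z = (x, y)" by fastforce
      have sub: "U \<subseteq> mspace m \<times> mspace n" using openin_subset[OF U] by simp
      then have xm: "x \<in> mspace m" and yn: "y \<in> mspace n" using z xy by auto
      obtain r where r: "r > 0" "\<And>u v. u \<in> mspace m \<Longrightarrow> v \<in> mspace n \<Longrightarrow> mdist m x u + mdist n y v < r \<Longrightarrow> (u, v) \<in> U"
        using U z xy unfolding openin_mtopology_of by fastforce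
      obtain k where k: "1 / real (Suc k) < r / 4"
        using reals_Archimedean[of "r / 4"] r by (auto simp: inverse_eq_divide)
      obtain c where c: "c \<in> C" "mdist m x c < 1 / real (Suc k)" using Cd[OF xm, of "1 / real (Suc k)"] by auto
      obtain d where d: "d \<in> D" "mdist n y d < 1 / real (Suc k)" using Dd[OF yn, of "1 / real (Suc k)"] by auto
      have "B (c, d, k) \<subseteq> U"
      proof (rule subsetI)
        fix w assume w: "w \<in> B (c, d, k)"
        obtain u v where uv: "w = (u, v)" by fastforce
        have uv': "u \<in> mspace m" "v \<in> mspace n" "mdist m c u < 1 / real (Suc k)" "mdist n d v < 1 / real (Suc k)"
          using w uv by (auto simp: B_def)
        have "c \<in> mspace m" "d \<in> mspace n" using c d C D by auto
        then have "mdist m x u + mdist n y v < r"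
          using mdist_triangle[of x m c u] mdist_triangle[of y n d v] uv' c(2) d(2) k xm yn by linarith
        then show "w \<in> U" using r uv uv' by simp
      qed
      then have "(c, d, k) \<in> I" using c d by (auto simp: I_def)
      moreover have "z \<in> B (c, d, k)"
        using c d C D xm yn xy by (auto simp: B_def mdist_commute)
      ultimately show "z \<in> (\<Union>i\<in>I. B i)" by blast
    qed
    then have "U = (\<Union>i\<in>I. B i)" by (auto simp: I_def)
    also have "\<dots> \<in> sets (borel_metric m \<Otimes>\<^sub>M borel_metric n)"
      using cI Bm by (intro sets.countable_UN'') auto
    finally show "U \<in> sets (borel_metric m \<Otimes>\<^sub>M borel_metric n)" .
  next
    show "mspace (sum_metric m n) \<in> sets (borel_metric m \<Otimes>\<^sub>M borel_metric n)"
      using sets.top[of "borel_metric m \<Otimes>\<^sub>M borel_metric n"] by (simp add: space_pair_measure)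
  qed
next
  have f: "fst \<in> borel_metric (sum_metric m n) \<rightarrow>\<^sub>M borel_metric m"
    and s: "snd \<in> borel_metric (sum_metric m n) \<rightarrow>\<^sub>M borel_metric n"
    by (auto intro!: continuous_map_borel_metric simp: mtopology_of_sum continuous_map_fst continuous_map_snd)
  have "(\<lambda>z. (fst z, snd z)) \<in> borel_metric (sum_metric m n) \<rightarrow>\<^sub>M borel_metric m \<Otimes>\<^sub>M borel_metric n"
    by (rule measurable_Pair[OF f s])
  then have id: "(\<lambda>z. z) \<in> borel_metric (sum_metric m n) \<rightarrow>\<^sub>M borel_metric m \<Otimes>\<^sub>M borel_metric n"
    by simp
  show "sets (borel_metric m \<Otimes>\<^sub>M borel_metric n) \<subseteq> sets (borel_metric (sum_metric m n))"
  proof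
    fix A assume A: "A \<in> sets (borel_metric m \<Otimes>\<^sub>M borel_metric n)"
    then have "A \<subseteq> mspace m \<times> mspace n" using sets.sets_into_space by (fastforce simp: space_pair_measure)
    then have "(\<lambda>z. z) -` A \<inter> space (borel_metric (sum_metric m n)) = A" by auto
    then show "A \<in> sets (borel_metric (sum_metric m n))" using measurable_sets[OF id A] by simp
  qed
qed

lemma mm_space_sum:
  assumes Y: "mm_space Y" and Z: "mm_space Z"
  shows "mm_space (mm_sum Y Z)"
proof -
  obtain m \<mu> n \<nu> where YZ: "Y = (m, \<mu>)" "Z = (n, \<nu>)" by fastforce
  interpret prob_space \<mu> using Y YZ by (simp add: mm_space_def)
  interpret N: prob_space \<nu> using Z YZ by (simp add: mm_space_def)
  interpret P: pair_prob_space \<mu> \<nu> ..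
  have sm: "sets \<mu> = sets (borel_metric m)" "sets \<nu> = sets (borel_metric n)"
    using Y Z YZ by (auto simp: mm_space_def)
  show ?thesis
    unfolding mm_space_def mm_sum_def YZ fst_conv snd_conv case_prod_conv
  proof (intro conjI allI impI)
    show "mcomplete_of (sum_metric m n)"
      using Y Z YZ by (auto simp: mm_space_def intro: mcomplete_of_sum)
    show "separable_space (mtopology_of (sum_metric m n))"
      using Y Z YZ by (auto simp: mm_space_def intro: separable_sum)
    show "sets (\<mu> \<Otimes>\<^sub>M \<nu>) = sets (borel_metric (sum_metric m n))"
      using sets_borel_metric_sum[of m n] sets_pair_measure_cong[OF sm] Y Z YZ by (auto simp: mm_space_def)
    show "prob_space (\<mu> \<Otimes>\<^sub>M \<nu>)" by (rule P.prob_space_axioms)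
    fix U assume U: "openin (mtopology_of (sum_metric m n)) U" "U \<noteq> {}"
    then obtain x y where xy: "(x, y) \<in> U" by fastforce
    obtain S T where ST: "openin (mtopology_of m) S" "openin (mtopology_of n) T" "x \<in> S" "y \<in> T" "S \<times> T \<subseteq> U"
      using openin_prod_topology_alt[THEN iffD1, OF U(1)[unfolded mtopology_of_sum], rule_format, OF xy]
      by (elim exE conjE)
    have m: "S \<in> sets \<mu>" "T \<in> sets \<nu>" using ST sm openin_borel_metric by auto
    have "0 < measure \<mu> S" "0 < measure \<nu> T"
      using ST Y Z unfolding mm_space_def YZ by blast+
    then have "0 < measure \<mu> S * measure \<nu> T" by (rule mult_pos_pos)
    also have "\<dots> = measure (\<mu> \<Otimes>\<^sub>M \<nu>) (S \<times> T)"
      using m by (simp add: measure_def N.emeasure_pair_measure_Times enn2real_mult)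
    also have "\<dots> \<le> measure (\<mu> \<Otimes>\<^sub>M \<nu>) U"
    proof (rule P.finite_measure_mono[OF ST(5)])
      show "U \<in> sets (\<mu> \<Otimes>\<^sub>M \<nu>)"
        unfolding \<open>sets (\<mu> \<Otimes>\<^sub>M \<nu>) = sets (borel_metric (sum_metric m n))\<close>
        by (rule openin_borel_metric[OF U(1)])
    qed
    finally show "0 < measure (\<mu> \<Otimes>\<^sub>M \<nu>) U" .
  qed
qed

lemma mm_equiv_sum:
  assumes sp: "mm_space Y" "mm_space Z" "mm_space Y'" "mm_space Z'"
    and e: "mm_equiv Y Y'" "mm_equiv Z Z'"
  shows "mm_equiv (mm_sum Y Z) (mm_sum Y' Z')"
proof -
  obtain \<phi> where \<phi>: "mm_isometry (fst Y) (fst Y') \<phi>" "distr (snd Y) (snd Y') \<phi> = snd Y'"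
    using e by (auto simp: mm_equiv_def split: prod.splits)
  obtain \<psi> where \<psi>: "mm_isometry (fst Z) (fst Z') \<psi>" "distr (snd Z) (snd Z') \<psi> = snd Z'"
    using e by (auto simp: mm_equiv_def split: prod.splits)
  have m1: "\<phi> \<in> snd Y \<rightarrow>\<^sub>M snd Y'" using sp \<phi> mm_isometry_embedding mm_isometry_measurable by metis
  have m2: "\<psi> \<in> snd Z \<rightarrow>\<^sub>M snd Z'" using sp \<psi> mm_isometry_embedding mm_isometry_measurable by metis
  have sf: "sigma_finite_measure (distr (snd Z) (snd Z') \<psi>)"
    using mm_space_prob[OF sp(4)] unfolding \<psi>(2)
    by (simp add: prob_space_imp_sigma_finite)
  have "distr (snd Y \<Otimes>\<^sub>M snd Z) (snd Y' \<Otimes>\<^sub>M snd Z') (\<lambda>(x, y). (\<phi> x, \<psi> y)) = snd Y' \<Otimes>\<^sub>M snd Z'"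
    using pair_measure_distr[OF m1 m2 sf] \<phi> \<psi> by simp
  moreover have "mm_isometry (sum_metric (fst Y) (fst Z)) (sum_metric (fst Y') (fst Z')) (\<lambda>(x, y). (\<phi> x, \<psi> y))"
    unfolding mm_isometry_def mspace_sum_metric mdist_sum_metric
  proof (intro conjI ballI)
    show "bij_betw (\<lambda>(x, y). (\<phi> x, \<psi> y)) (mspace (fst Y) \<times> mspace (fst Z)) (mspace (fst Y') \<times> mspace (fst Z'))"
      using \<phi>(1) \<psi>(1) bij_betw_map_prod unfolding mm_isometry_def map_prod_def by blast
    fix x y assume "x \<in> mspace (fst Y) \<times> mspace (fst Z)" "y \<in> mspace (fst Y) \<times> mspace (fst Z)"
    then show "(case case x of (x, y) \<Rightarrow> (\<phi> x, \<psi> y) of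
        (y', z') \<Rightarrow> \<lambda>(y'', z''). mdist (fst Y') y' y'' + mdist (fst Z') z' z'')
          (case y of (x, y) \<Rightarrow> (\<phi> x, \<psi> y)) =
        (case x of (y', z') \<Rightarrow> \<lambda>(y'', z''). mdist (fst Y) y' y'' + mdist (fst Z) z' z'') y"
      using \<phi>(1) \<psi>(1) by (cases x; cases y) (simp add: mm_isometry_def)
  qed
  ultimately show ?thesis by (auto simp: mm_equiv_def mm_sum_def)
qed

text \<open>The Gromov-Prohorov distance respects equivalence, and restricting the ambient spaces to
  sets of reals does not change it (only the union of the two images matters).\<close>

lemma closedin_mtopology_of:
  "closedin (mtopology_of m) F \<longleftrightarrow>
     F \<subseteq> mspace m \<and> (\<forall>x\<in>mspace m - F. \<exists>r>0. \<forall>y\<in>F. r \<le> mdist m x y)"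
proof (cases "F \<subseteq> mspace m")
  case True
  then have "(\<forall>y\<in>mspace m. mdist m x y < r \<longrightarrow> y \<in> mspace m - F) \<longleftrightarrow> (\<forall>y\<in>F. r \<le> mdist m x y)" for x r
    by (auto simp: not_less subset_iff simp flip: not_le)
  with True show ?thesis
    unfolding closedin_def openin_mtopology_of topspace_mtopology_of by simp
qed (auto simp: closedin_def)

lemma openin_nhd_of:
  assumes "F \<subseteq> mspace m"
  shows "openin (mtopology_of m) (nhd_of m F \<epsilon>)"
  unfolding openin_mtopology_of
proof (intro conjI ballI)
  fix x assume "x \<in> nhd_of m F \<epsilon>"
  then obtain z where z: "x \<in> mspace m" "z \<in> F" "mdist m x z < \<epsilon>" by (auto simp: nhd_of_def)
  show "\<exists>r>0. \<forall>y\<in>mspace m. mdist m x y < r \<longrightarrow> y \<in> nhd_of m F \<epsilon>"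
  proof (intro exI[of _ "\<epsilon> - mdist m x z"] conjI ballI impI)
    fix y assume y: "y \<in> mspace m" "mdist m x y < \<epsilon> - mdist m x z"
    then have "mdist m y z < \<epsilon>"
      using mdist_triangle[of y m x z] z assms mdist_commute[of m x y] by auto
    with y z show "y \<in> nhd_of m F \<epsilon>" by (auto simp: nhd_of_def)
  qed (use z in auto)
qed (auto simp: nhd_of_def)

lemma isometric_embedding_comp:
  "isometric_embedding m n \<phi> \<Longrightarrow> isometric_embedding n k \<theta> \<Longrightarrow> isometric_embedding m k (\<theta> \<circ> \<phi>)"
  unfolding isometric_embedding_def by (simp add: image_subset_iff)

lemma embedding_measurable:
  assumes "mm_space X" "isometric_embedding (fst X) m \<phi>"
  shows "\<phi> \<in> snd X \<rightarrow>\<^sub>M borel_metric m"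
  using isometric_embedding_measurable[OF assms(2)]
  unfolding measurable_cong_sets[OF mm_space_sets[OF assms(1)] refl] .

lemma embedded_prohorov_comp:
  assumes X: "mm_space X" and Y: "mm_space Y"
    and \<phi>: "isometric_embedding (fst X) n \<phi>" and \<psi>: "isometric_embedding (fst Y) n \<psi>"
    and \<theta>: "isometric_embedding n m \<theta>"
  shows "embedded_prohorov X Y m (\<theta> \<circ> \<phi>) (\<theta> \<circ> \<psi>) = embedded_prohorov X Y n \<phi> \<psi>"
proof -
  interpret Y: prob_space "snd Y" by (rule mm_space_prob[OF Y])
  have d: "mdist m (\<theta> x) (\<theta> y) = mdist n x y" if "x \<in> mspace n" "y \<in> mspace n" for x y
    using \<theta> that by (auto simp: isometric_embedding_def)
  have t: "\<theta> x \<in> mspace m" if "x \<in> mspace n" for x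
    using \<theta> that by (auto simp: isometric_embedding_def)
  have fx: "\<phi> x \<in> mspace n" if "x \<in> space (snd X)" for x
    using \<phi> that by (auto simp: isometric_embedding_def mm_space_space[OF X])
  have fy: "\<psi> x \<in> mspace n" if "x \<in> space (snd Y)" for x
    using \<psi> that by (auto simp: isometric_embedding_def mm_space_space[OF Y])
  note e1 = embedding_measurable[OF X isometric_embedding_comp[OF \<phi> \<theta>]]
    and e2 = embedding_measurable[OF Y isometric_embedding_comp[OF \<psi> \<theta>]]
    and e3 = embedding_measurable[OF X \<phi>] and e4 = embedding_measurable[OF Y \<psi>]
  let ?mX = "distr (snd X) (borel_metric m) (\<theta> \<circ> \<phi>)" and ?mY = "distr (snd Y) (borel_metric m) (\<theta> \<circ> \<psi>)"
  let ?nX = "distr (snd X) (borel_metric n) \<phi>" and ?nY = "distr (snd Y) (borel_metric n) \<psi>"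
  have "(\<forall>F. closedin (mtopology_of m) F \<longrightarrow> measure ?mX F \<le> measure ?mY (nhd_of m F \<epsilon>) + \<epsilon>) \<longleftrightarrow>
        (\<forall>F. closedin (mtopology_of n) F \<longrightarrow> measure ?nX F \<le> measure ?nY (nhd_of n F \<epsilon>) + \<epsilon>)" for \<epsilon>
  proof (intro iffI allI impI)
    fix F assume H: "\<forall>F. closedin (mtopology_of m) F \<longrightarrow> measure ?mX F \<le> measure ?mY (nhd_of m F \<epsilon>) + \<epsilon>"
      and F: "closedin (mtopology_of n) F"
    have Fn: "F \<subseteq> mspace n" using closedin_subset[OF F] by simp
    define G where "G = {w \<in> mspace m. \<forall>e>0. \<exists>f\<in>F. mdist m w (\<theta> f) < e}"
    have G: "closedin (mtopology_of m) G"
      unfolding closedin_mtopology_of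
    proof (intro conjI ballI)
      fix x assume x: "x \<in> mspace m - G"
      then obtain e where e: "e > 0" "\<And>f. f \<in> F \<Longrightarrow> e \<le> mdist m x (\<theta> f)"
        by (auto simp: G_def not_less)
      show "\<exists>r>0. \<forall>y\<in>G. r \<le> mdist m x y"
      proof (intro exI[of _ "e / 2"] conjI ballI)
        fix y assume y: "y \<in> G"
        have "e / 2 > 0" using e by simp
        with y obtain f where f: "f \<in> F" "mdist m y (\<theta> f) < e / 2" unfolding G_def by blast
        have "y \<in> mspace m" "\<theta> f \<in> mspace m" "x \<in> mspace m"
          using y f Fn t x by (auto simp: G_def)
        then have "mdist m x (\<theta> f) \<le> mdist m x y + mdist m y (\<theta> f)" by (intro mdist_triangle)
        with f e(2)[OF f(1)] show "e / 2 \<le> mdist m x y" by linarith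
      qed (use e in auto)
    qed (auto simp: G_def)
    have a: "\<theta> z \<in> G \<longleftrightarrow> z \<in> F" if z: "z \<in> mspace n" for z
    proof
      assume zF: "z \<in> F"
      have "mdist m (\<theta> z) (\<theta> z) < e" if "e > 0" for e
        using t[OF z] mdist_zero[of "\<theta> z" m "\<theta> z"] that by metis
      with zF t[OF z] show "\<theta> z \<in> G" unfolding G_def by blast
    next
      assume g: "\<theta> z \<in> G"
      show "z \<in> F"
      proof (rule ccontr)
        assume "z \<notin> F"
        with F z obtain r where r: "r > 0" "\<forall>y\<in>F. r \<le> mdist n z y"
          unfolding closedin_mtopology_of by blast
        then obtain f where "f \<in> F" "mdist m (\<theta> z) (\<theta> f) < r" using g by (auto simp: G_def)
        with r d[of z f] z Fn show False by fastforce
      qed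
    qed
    have b: "z \<in> nhd_of n F \<epsilon>" if z: "z \<in> mspace n" "\<theta> z \<in> nhd_of m G \<epsilon>" for z
    proof -
      from z obtain w where w: "w \<in> G" "mdist m (\<theta> z) w < \<epsilon>" by (auto simp: nhd_of_def)
      then have "\<epsilon> - mdist m (\<theta> z) w > 0" by simp
      with w obtain f where f: "f \<in> F" "mdist m w (\<theta> f) < \<epsilon> - mdist m (\<theta> z) w" unfolding G_def by blast
      have "mdist m (\<theta> z) (\<theta> f) \<le> mdist m (\<theta> z) w + mdist m w (\<theta> f)"
        using w f Fn t z by (intro mdist_triangle) (auto simp: G_def)
      then have "mdist n z f < \<epsilon>" using f d[of z f] z Fn by auto
      then show ?thesis using z f by (auto simp: nhd_of_def)
    qed
    have "measure ?nX F = measure (snd X) (\<phi> -` F \<inter> space (snd X))"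
      by (rule measure_distr[OF e3 closedin_borel_metric[OF F]])
    also have "\<phi> -` F \<inter> space (snd X) = (\<theta> \<circ> \<phi>) -` G \<inter> space (snd X)"
      using a fx by auto
    also have "measure (snd X) \<dots> = measure ?mX G"
      by (rule measure_distr[OF e1 closedin_borel_metric[OF G], symmetric])
    also have "\<dots> \<le> measure ?mY (nhd_of m G \<epsilon>) + \<epsilon>" using H G by blast
    also have "measure ?mY (nhd_of m G \<epsilon>) = measure (snd Y) ((\<theta> \<circ> \<psi>) -` nhd_of m G \<epsilon> \<inter> space (snd Y))"
      by (intro measure_distr[OF e2] openin_borel_metric openin_nhd_of) (auto simp: G_def)
    also have "\<dots> \<le> measure (snd Y) (\<psi> -` nhd_of n F \<epsilon> \<inter> space (snd Y))"
      using b fy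
      by (intro Y.finite_measure_mono measurable_sets[OF e4] openin_borel_metric openin_nhd_of Fn) auto
    also have "\<dots> = measure ?nY (nhd_of n F \<epsilon>)"
      by (intro measure_distr[OF e4, symmetric] openin_borel_metric openin_nhd_of Fn)
    finally show "measure ?nX F \<le> measure ?nY (nhd_of n F \<epsilon>) + \<epsilon>" by (simp only: add_right_mono)
  next
    fix F assume H: "\<forall>F. closedin (mtopology_of n) F \<longrightarrow> measure ?nX F \<le> measure ?nY (nhd_of n F \<epsilon>) + \<epsilon>"
      and F: "closedin (mtopology_of m) F"
    have Fm: "F \<subseteq> mspace m" using closedin_subset[OF F] by simp
    define G where "G = {z \<in> topspace (mtopology_of n). \<theta> z \<in> F}"
    have G: "closedin (mtopology_of n) G"
      unfolding G_def
      by (rule closedin_continuous_map_preimage[OF isometric_embedding_continuous[OF \<theta>] F])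
    have Gn: "G \<subseteq> mspace n" by (auto simp: G_def)
    have b: "\<theta> z \<in> nhd_of m F \<epsilon>" if zG: "z \<in> nhd_of n G \<epsilon>" for z
    proof -
      obtain w where w: "z \<in> mspace n" "w \<in> mspace n" "\<theta> w \<in> F" "mdist n z w < \<epsilon>"
        using zG by (auto simp: nhd_of_def G_def)
      then have "mdist m (\<theta> z) (\<theta> w) < \<epsilon>" using d by simp
      with w t show ?thesis unfolding nhd_of_def by blast
    qed
    have "measure ?mX F = measure (snd X) ((\<theta> \<circ> \<phi>) -` F \<inter> space (snd X))"
      by (rule measure_distr[OF e1 closedin_borel_metric[OF F]])
    also have "(\<theta> \<circ> \<phi>) -` F \<inter> space (snd X) = \<phi> -` G \<inter> space (snd X)"
      using fx by (auto simp: G_def)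
    also have "measure (snd X) \<dots> = measure ?nX G"
      by (rule measure_distr[OF e3 closedin_borel_metric[OF G], symmetric])
    also have "\<dots> \<le> measure ?nY (nhd_of n G \<epsilon>) + \<epsilon>" using H G by blast
    also have "measure ?nY (nhd_of n G \<epsilon>) = measure (snd Y) (\<psi> -` nhd_of n G \<epsilon> \<inter> space (snd Y))"
      by (intro measure_distr[OF e4] openin_borel_metric openin_nhd_of Gn)
    also have "\<dots> \<le> measure (snd Y) ((\<theta> \<circ> \<psi>) -` nhd_of m F \<epsilon> \<inter> space (snd Y))"
      using b
      by (intro Y.finite_measure_mono measurable_sets[OF e2] openin_borel_metric openin_nhd_of Fm) auto
    also have "\<dots> = measure ?mY (nhd_of m F \<epsilon>)"
      by (intro measure_distr[OF e2, symmetric] openin_borel_metric openin_nhd_of Fm)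
    finally show "measure ?mX F \<le> measure ?mY (nhd_of m F \<epsilon>) + \<epsilon>" by (simp only: add_right_mono)
  qed
  then show ?thesis unfolding embedded_prohorov_def prohorov_def by simp
qed

lemma embedded_prohorov_nonneg:
  assumes X: "mm_space X" and \<phi>: "isometric_embedding (fst X) m \<phi>"
  shows "0 \<le> embedded_prohorov X Y m \<phi> \<psi>"
  unfolding embedded_prohorov_def prohorov_def
proof (rule cInf_greatest)
  interpret prob_space "distr (snd X) (borel_metric m) \<phi>"
    by (rule prob_space.prob_space_distr[OF mm_space_prob[OF X] embedding_measurable[OF X \<phi>]])
  have "prob F \<le> measure (distr (snd Y) (borel_metric m) \<psi>) (nhd_of m F 1) + 1" for F
    using prob_le_1[of F] measure_nonneg[of "distr (snd Y) (borel_metric m) \<psi>" "nhd_of m F 1"]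
    by linarith
  then have "1 \<in> {\<epsilon>. 0 < \<epsilon> \<and> (\<forall>F. closedin (mtopology_of m) F \<longrightarrow>
      prob F \<le> measure (distr (snd Y) (borel_metric m) \<psi>) (nhd_of m F \<epsilon>) + \<epsilon>)}" by simp
  then show "{\<epsilon>. 0 < \<epsilon> \<and> (\<forall>F. closedin (mtopology_of m) F \<longrightarrow>
      prob F \<le> measure (distr (snd Y) (borel_metric m) \<psi>) (nhd_of m F \<epsilon>) + \<epsilon>)} \<noteq> {}" by blast
qed simp

lemma gromov_prohorov_le:
  fixes n :: "'z metric"
  assumes X: "mm_space X" and Y: "mm_space Y"
    and \<phi>: "isometric_embedding (fst X) n \<phi>" and \<psi>: "isometric_embedding (fst Y) n \<psi>"
  shows "gromov_prohorov X Y \<le> embedded_prohorov X Y n \<phi> \<psi>"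
proof -
  define S where "S = \<phi> ` mspace (fst X) \<union> \<psi> ` mspace (fst Y)"
  have Sn: "S \<subseteq> mspace n" using \<phi> \<psi> by (auto simp: S_def isometric_embedding_def)
  define k where "k = submetric n S"
  have k: "mspace k = S" "mdist k = mdist n" using Sn by (auto simp: k_def)
  obtain f :: "'a \<Rightarrow> real" where f: "inj_on f (mspace (fst X))"
    using separable_inj_real[of "fst X"] X by (auto simp: mm_space_def)
  obtain g :: "'b \<Rightarrow> real" where g: "inj_on g (mspace (fst Y))"
    using separable_inj_real[of "fst Y"] Y by (auto simp: mm_space_def)
  define h where "h = (\<lambda>s. if s \<in> \<phi> ` mspace (fst X)
    then exp (f (inv_into (mspace (fst X)) \<phi> s)) else - exp (g (inv_into (mspace (fst Y)) \<psi> s)))"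
  have "inj_on h S"
  proof (rule inj_onI)
    fix s t assume st: "s \<in> S" "t \<in> S" "h s = h t"
    have neq: "exp u \<noteq> - exp v" for u v :: real
      using exp_gt_zero[of u] exp_gt_zero[of v] by linarith
    show "s = t"
    proof (cases "s \<in> \<phi> ` mspace (fst X)")
      case True
      then have t: "t \<in> \<phi> ` mspace (fst X)"
        using st(3) neq by (auto simp: h_def split: if_splits)
      then have "f (inv_into (mspace (fst X)) \<phi> s) = f (inv_into (mspace (fst X)) \<phi> t)"
        using True st(3) by (simp add: h_def)
      then have "inv_into (mspace (fst X)) \<phi> s = inv_into (mspace (fst X)) \<phi> t"
        using f True t by (meson inj_onD inv_into_into)
      then show ?thesis using True t by (metis f_inv_into_f)
    next
      case False
      then have t: "t \<notin> \<phi> ` mspace (fst X)"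
        using st(3) neq by (metis h_def)
      with False st have sY: "s \<in> \<psi> ` mspace (fst Y)" "t \<in> \<psi> ` mspace (fst Y)"
        by (auto simp: S_def)
      have "g (inv_into (mspace (fst Y)) \<psi> s) = g (inv_into (mspace (fst Y)) \<psi> t)"
        using False t st(3) by (simp add: h_def)
      then have "inv_into (mspace (fst Y)) \<psi> s = inv_into (mspace (fst Y)) \<psi> t"
        using g sY by (meson inj_onD inv_into_into)
      then show ?thesis using sY by (metis f_inv_into_f)
    qed
  qed
  then obtain l :: "real metric" where "mm_isometry k l h"
    using ex_isometric_copy[of h k] k by auto
  then have h: "isometric_embedding k l h" by (rule mm_isometry_embedding)
  have id: "isometric_embedding k n (\<lambda>x. x)"
    using Sn by (auto simp: isometric_embedding_def k)
  have \<phi>k: "isometric_embedding (fst X) k \<phi>" and \<psi>k: "isometric_embedding (fst Y) k \<psi>"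
    using \<phi> \<psi> by (auto simp: isometric_embedding_def k S_def)
  have "embedded_prohorov X Y n \<phi> \<psi> = embedded_prohorov X Y k \<phi> \<psi>"
    using embedded_prohorov_comp[OF X Y \<phi>k \<psi>k id] by (simp add: comp_def)
  also have "\<dots> = embedded_prohorov X Y l (h \<circ> \<phi>) (h \<circ> \<psi>)"
    by (rule embedded_prohorov_comp[OF X Y \<phi>k \<psi>k h, symmetric])
  also have "\<dots> \<ge> gromov_prohorov X Y"
    unfolding gromov_prohorov_def
  proof (rule cInf_lower)
    show "embedded_prohorov X Y l (h \<circ> \<phi>) (h \<circ> \<psi>) \<in> {embedded_prohorov X Y m \<phi> \<psi> | (m :: real metric) \<phi> \<psi>.
        isometric_embedding (fst X) m \<phi> \<and> isometric_embedding (fst Y) m \<psi>}"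
      using isometric_embedding_comp[OF \<phi>k h] isometric_embedding_comp[OF \<psi>k h] by blast
    show "bdd_below {embedded_prohorov X Y m \<phi> \<psi> | (m :: real metric) \<phi> \<psi>.
        isometric_embedding (fst X) m \<phi> \<and> isometric_embedding (fst Y) m \<psi>}"
      by (rule bdd_belowI[of _ 0]) (use embedded_prohorov_nonneg[OF X] in blast)
  qed
  finally show ?thesis .
qed

lemma gromov_prohorov_mono_equiv:
  assumes sp: "mm_space X" "mm_space Y" "mm_space X'" "mm_space Y'"
    and e: "mm_equiv X X'" "mm_equiv Y Y'"
  shows "gromov_prohorov X Y = gromov_prohorov X' Y'"
proof -
  have *: "\<exists>\<phi>' \<psi>'. isometric_embedding (fst X) m \<phi>' \<and> isometric_embedding (fst Y) m \<psi>' \<and>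
     embedded_prohorov X Y m \<phi>' \<psi>' = embedded_prohorov X' Y' m \<phi> \<psi>"
    if sp: "mm_space X" "mm_space Y" "mm_space X'" "mm_space Y'"
    and e: "mm_equiv X X'" "mm_equiv Y Y'"
    and em: "isometric_embedding (fst X') m \<phi>" "isometric_embedding (fst Y') m \<psi>"
    for X :: "'p mm" and Y :: "'q mm" and X' :: "'r mm" and Y' :: "'s mm" and m :: "real metric" and \<phi> \<psi>
  proof -
    obtain \<alpha> where \<alpha>: "mm_isometry (fst X) (fst X') \<alpha>" "distr (snd X) (snd X') \<alpha> = snd X'"
      using e by (auto simp: mm_equiv_def split: prod.splits)
    obtain \<beta> where \<beta>: "mm_isometry (fst Y) (fst Y') \<beta>" "distr (snd Y) (snd Y') \<beta> = snd Y'"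
      using e by (auto simp: mm_equiv_def split: prod.splits)
    have m1: "\<alpha> \<in> snd X \<rightarrow>\<^sub>M snd X'" using sp \<alpha> mm_isometry_embedding mm_isometry_measurable by metis
    have m2: "\<beta> \<in> snd Y \<rightarrow>\<^sub>M snd Y'" using sp \<beta> mm_isometry_embedding mm_isometry_measurable by metis
    have "embedded_prohorov X Y m (\<phi> \<circ> \<alpha>) (\<psi> \<circ> \<beta>) = embedded_prohorov X' Y' m \<phi> \<psi>"
      unfolding embedded_prohorov_def
      using distr_distr[OF embedding_measurable[OF sp(3) em(1)] m1]
        distr_distr[OF embedding_measurable[OF sp(4) em(2)] m2] \<alpha> \<beta> by simp
    then show ?thesis
      using isometric_embedding_comp[OF mm_isometry_embedding[OF \<alpha>(1)] em(1)]
        isometric_embedding_comp[OF mm_isometry_embedding[OF \<beta>(1)] em(2)] by blast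
  qed
  have "{embedded_prohorov X Y m \<phi> \<psi> | (m :: real metric) \<phi> \<psi>.
      isometric_embedding (fst X) m \<phi> \<and> isometric_embedding (fst Y) m \<psi>} =
    {embedded_prohorov X' Y' m \<phi> \<psi> | (m :: real metric) \<phi> \<psi>.
      isometric_embedding (fst X') m \<phi> \<and> isometric_embedding (fst Y') m \<psi>}" (is "?A = ?B")
  proof
    show "?B \<subseteq> ?A"
      using *[OF sp e] by (smt (verit, best) Collect_mono)
    show "?A \<subseteq> ?B"
      using *[OF sp(3,4,1,2) mm_equiv_sym[OF sp(1,3) e(1)] mm_equiv_sym[OF sp(2,4) e(2)]]
      by (smt (verit, best) Collect_mono)
  qed
  then show ?thesis by (simp add: gromov_prohorov_def)
qed

section \<open>Equivalence classes\<close>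

text \<open>By \<open>mm_real_copy\<close> every equivalence class has a representative whose carrier is a set of reals,
  so the set of all classes is the quotient of the metric measure spaces of type \<^typ>\<open>real mm\<close>.
  \<open>mm_class X\<close> is the class of a metric measure space over an arbitrary type.\<close>

quotient_type mmc = "real mm" / partial: "\<lambda>X Y. mm_space X \<and> mm_space Y \<and> mm_equiv X Y"
proof (rule part_equivpI)
  obtain X :: "real mm" where "mm_space X" using mm_real_copy[OF mm_space_point] by blast
  then show "\<exists>X::real mm. mm_space X \<and> mm_space X \<and> mm_equiv X X" using mm_equiv_refl by blast
  show "symp (\<lambda>X Y :: real mm. mm_space X \<and> mm_space Y \<and> mm_equiv X Y)"
    using mm_equiv_sym by (auto intro!: sympI)
  show "transp (\<lambda>X Y :: real mm. mm_space X \<and> mm_space Y \<and> mm_equiv X Y)"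
    using mm_equiv_trans by (blast intro: transpI)
qed

definition mm_class :: "'a mm \<Rightarrow> mmc" where
  "mm_class X = abs_mmc (SOME Y. mm_space Y \<and> mm_equiv X Y)"

definition one_point :: mmc ("\<E>") where
  "\<E> = mm_class mm_point"

definition boxplus :: "mmc \<Rightarrow> mmc \<Rightarrow> mmc" (infixl "\<boxplus>" 65) where
  "\<Y> \<boxplus> \<Z> = mm_class (mm_sum (rep_mmc \<Y>) (rep_mmc \<Z>))"

text \<open>Only meaningful for \<open>a > 0\<close>.\<close>

definition scale :: "real \<Rightarrow> mmc \<Rightarrow> mmc" (infixr "\<odot>" 75) where
  "a \<odot> \<X> = mm_class (mm_scale a (rep_mmc \<X>))"

definition mmc_le :: "mmc \<Rightarrow> mmc \<Rightarrow> bool" (infix "\<preceq>" 50) where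
  "\<Y> \<preceq> \<Z> \<longleftrightarrow> (\<exists>\<W>. \<Z> = \<Y> \<boxplus> \<W>)"

definition d_GPr :: "mmc \<Rightarrow> mmc \<Rightarrow> real" where
  "d_GPr \<X> \<Y> = gromov_prohorov (rep_mmc \<X>) (rep_mmc \<Y>)"

text \<open>\<open>boxplus_upto f n\<close> is \<open>f 1 \<boxplus> \<dots> \<boxplus> f n\<close>; the empty sum is \<open>\<E>\<close>.\<close>

primrec boxplus_upto :: "(nat \<Rightarrow> mmc) \<Rightarrow> nat \<Rightarrow> mmc" where
  "boxplus_upto f 0 = \<E>"
| "boxplus_upto f (Suc n) = boxplus_upto f n \<boxplus> f (Suc n)"

definition boxplus_sums :: "(nat \<Rightarrow> mmc) \<Rightarrow> mmc \<Rightarrow> bool" where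
  "boxplus_sums f \<X> \<longleftrightarrow> (\<lambda>n. d_GPr (boxplus_upto f n) \<X>) \<longlonglongrightarrow> 0"

text \<open>None of these notions depends on the chosen representatives.\<close>

lemma mm_space_rep: "mm_space (rep_mmc \<X>)"
  using Quotient3_rep_reflp[OF Quotient3_mmc] by blast

lemma abs_mmc_eq_iff: "mm_space X \<Longrightarrow> mm_space Y \<Longrightarrow> abs_mmc X = abs_mmc Y \<longleftrightarrow> mm_equiv X Y"
  using Quotient3_rel[OF Quotient3_mmc, of X Y] mm_equiv_refl by blast

lemma mm_class_some:
  assumes "mm_space X"
  obtains Y where "mm_space Y" "mm_equiv X Y" "mm_class X = abs_mmc Y"
  using someI_ex[OF mm_real_copy[OF assms]] unfolding mm_class_def by blast

lemma mm_class_eq_iff: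
  assumes "mm_space X" "mm_space Y"
  shows "mm_class X = mm_class Y \<longleftrightarrow> mm_equiv X Y"
proof -
  obtain X' where X': "mm_space X'" "mm_equiv X X'" "mm_class X = abs_mmc X'"
    by (rule mm_class_some[OF assms(1)])
  obtain Y' where Y': "mm_space Y'" "mm_equiv Y Y'" "mm_class Y = abs_mmc Y'"
    by (rule mm_class_some[OF assms(2)])
  note sX = mm_equiv_sym[OF assms(1) X'(1,2)] and sY = mm_equiv_sym[OF assms(2) Y'(1,2)]
  have "mm_equiv X' Y' \<longleftrightarrow> mm_equiv X Y"
  proof
    assume "mm_equiv X' Y'"
    then have "mm_equiv X Y'" by (rule mm_equiv_trans[OF assms(1) X'(1) Y'(1) X'(2)])
    then show "mm_equiv X Y" by (rule mm_equiv_trans[OF assms(1) Y'(1) assms(2) _ sY])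
  next
    assume "mm_equiv X Y"
    then have "mm_equiv X' Y" by (rule mm_equiv_trans[OF X'(1) assms sX])
    then show "mm_equiv X' Y'" by (rule mm_equiv_trans[OF X'(1) assms(2) Y'(1) _ Y'(2)])
  qed
  then show ?thesis using X' Y' abs_mmc_eq_iff by simp
qed

lemma mm_class_rep [simp]: "mm_class (rep_mmc \<X>) = \<X>"
  using mm_class_some[OF mm_space_rep[of \<X>]] abs_mmc_eq_iff[OF mm_space_rep[of \<X>]]
    Quotient3_abs_rep[OF Quotient3_mmc, of \<X>]
  by metis

lemma rep_mm_class: "mm_space X \<Longrightarrow> mm_equiv X (rep_mmc (mm_class X))"
  using mm_class_eq_iff[of X "rep_mmc (mm_class X)"] mm_space_rep by simp

lemma boxplus_mm_class:
  assumes "mm_space Y" "mm_space Z"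
  shows "mm_class Y \<boxplus> mm_class Z = mm_class (mm_sum Y Z)"
  unfolding boxplus_def using assms
  by (subst mm_class_eq_iff)
    (auto intro!: mm_space_sum mm_space_rep mm_equiv_sum intro: mm_equiv_sym rep_mm_class)

lemma scale_mm_class:
  assumes "0 < a" "mm_space X"
  shows "a \<odot> mm_class X = mm_class (mm_scale a X)"
  unfolding scale_def using assms
  by (subst mm_class_eq_iff)
    (auto intro!: mm_space_scale mm_space_rep mm_equiv_scale intro: mm_equiv_sym rep_mm_class)

lemma d_GPr_mm_class:
  assumes "mm_space X" "mm_space Y"
  shows "d_GPr (mm_class X) (mm_class Y) = gromov_prohorov X Y"
  unfolding d_GPr_def using assms
  by (intro gromov_prohorov_mono_equiv mm_space_rep mm_equiv_sym[OF _ _ rep_mm_class])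

end

theory Submission
  imports Defs
begin

text \<open>
  For independent samples \<open>\<xi>\<close> and \<open>\<eta>\<close> of a metric measure space \<open>X\<close>, the Laplace transform
  \<open>L\<^sub>t(X) = E exp (- t r(\<xi>,\<eta>))\<close> is multiplicative under \<open>\<boxplus>\<close>, satisfies \<open>L\<^sub>t(a X) = L\<^sub>t\<^sub>a(X)\<close>, and is
  strictly decreasing in \<open>t\<close> unless \<open>X\<close> has one point.

  (a) If \<open>a X = X \<boxplus> Z\<close>, then \<open>L\<^sub>a(X) = L\<^sub>1(X) L\<^sub>1(Z) \<le> L\<^sub>1(X)\<close>, so \<open>a < 1\<close> is impossible unless \<open>X\<close> has
  one point. Iterating \<open>X = a\<^sup>-\<^sup>1 X \<boxplus> a\<^sup>-\<^sup>1 Z\<close> exhibits \<open>X\<close> as the \<open>n\<close>-th partial sum plus the remainder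
  \<open>a\<^sup>-\<^sup>n X\<close> (\<open>boxplus_upto_remainder\<close>). A summand that is concentrated near one of its points moves
  a space only a little in the Gromov-Prohorov metric (\<open>gromov_prohorov_sum_le\<close>), so the partial
  sums converge to \<open>X\<close>.

  (b) Scaling gives \<open>X = p X \<boxplus> q X\<close> with \<open>p = a / c\<close> and \<open>q = b / c\<close>. If \<open>X\<close> had more than one point,
  then \<open>p, q < 1\<close>, because \<open>L\<^sub>1(X) = L\<^sub>p(X) L\<^sub>q(X) < L\<^sub>p(X)\<close>. Splitting repeatedly, \<open>X\<close> becomes a sum of
  many tiny independent parts. In a tiny part most of the mass is close together, and two given
  samples are rarely both outliers. This suggests that the distance in \<open>X\<close> is of the form
  \<open>D(\<xi>) + D(\<eta>)\<close>, where \<open>D\<close> adds up the contributions of the outliers, plus a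
  constant. A positive constant contradicts the fact that two samples are arbitrarily close with
  positive probability. To avoid constructing \<open>D\<close>, consider the cross difference
  \<open>\<Delta> = r(x,y) + r(x',y') - r(x,y') - r(x',y)\<close> of four samples, which would vanish. It satisfies
  \<open>\<bar>\<Delta>\<bar> \<le> 2 min (r(x,x')) (r(y,y'))\<close>, a minimum of two independent quantities, and it is additive under
  \<open>\<boxplus>\<close>. Hence \<open>E (1 - exp (- \<bar>\<Delta>\<bar>))\<close> is at most the sum of its analogues over the tiny parts, and the
  estimate \<open>cross_defect_le\<close> shows that this sum is arbitrarily small (\<open>self_similar_one_point\<close>). So
  \<open>\<Delta> = 0\<close> almost surely, which by full support is impossible when there are two different points
  (\<open>cross_defect_eq_0_imp_one_point\<close>).
\<close>

section \<open>Measure-preserving maps\<close>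

definition measure_preserving :: "'a measure \<Rightarrow> 'b measure \<Rightarrow> ('a \<Rightarrow> 'b) \<Rightarrow> bool" where
  "measure_preserving M N f \<longleftrightarrow> f \<in> M \<rightarrow>\<^sub>M N \<and> distr M N f = N"

lemma measure_preserving_integral:
  fixes g :: "'b \<Rightarrow> real"
  assumes "measure_preserving M N f" and "g \<in> borel_measurable N"
  shows "(\<integral>x. g (f x) \<partial>M) = (\<integral>y. g y \<partial>N)"
  using assms integral_distr[of f M N g] by (simp add: measure_preserving_def)

lemma measure_preserving_map_prod:
  assumes "measure_preserving M N f" "measure_preserving M' N' f'" and "prob_space N'"
  shows "measure_preserving (M \<Otimes>\<^sub>M M') (N \<Otimes>\<^sub>M N') (map_prod f f')"
  unfolding measure_preserving_def map_prod_def
proof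
  show "(\<lambda>(x, y). (f x, f' y)) \<in> M \<Otimes>\<^sub>M M' \<rightarrow>\<^sub>M N \<Otimes>\<^sub>M N'"
    using assms unfolding measure_preserving_def by (auto intro!: measurable_Pair simp: split_beta')
  show "distr (M \<Otimes>\<^sub>M M') (N \<Otimes>\<^sub>M N') (\<lambda>(x, y). (f x, f' y)) = N \<Otimes>\<^sub>M N'"
    using pair_measure_distr[of f M N f' M' N'] assms prob_space_imp_sigma_finite[of N']
    by (simp add: measure_preserving_def)
qed

lemma measure_preserving_fst:
  assumes "prob_space M" "prob_space N"
  shows "measure_preserving (M \<Otimes>\<^sub>M N) M fst"
  using prob_space.distr_pair_fst[OF assms(2)] by (simp add: measure_preserving_def)

lemma measure_preserving_snd:
  assumes "prob_space M" "prob_space N"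
  shows "measure_preserving (M \<Otimes>\<^sub>M N) N snd"
  unfolding measure_preserving_def
proof
  interpret M: prob_space M by fact
  interpret N: prob_space N by fact
  show "distr (M \<Otimes>\<^sub>M N) N snd = N"
  proof (rule measure_eqI)
    fix A assume A: "A \<in> sets (distr (M \<Otimes>\<^sub>M N) N snd)"
    then have "snd -` A \<inter> space (M \<Otimes>\<^sub>M N) = space M \<times> A"
      by (auto simp: space_pair_measure dest: sets.sets_into_space)
    then show "emeasure (distr (M \<Otimes>\<^sub>M N) N snd) A = emeasure N A"
      using A by (simp add: emeasure_distr N.emeasure_pair_measure_Times M.emeasure_space_1)
  qed simp
qed simp

lemma mm_equiv_measure_preserving:
  assumes X: "mm_space X" and Y: "mm_space Y" and e: "mm_equiv X Y"
  obtains \<phi> where "mm_isometry (fst X) (fst Y) \<phi>" and "measure_preserving (snd X) (snd Y) \<phi>"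
proof -
  obtain \<phi> where \<phi>: "mm_isometry (fst X) (fst Y) \<phi>" "distr (snd X) (snd Y) \<phi> = snd Y"
    using e by (auto simp: mm_equiv_def split: prod.splits)
  then show thesis
    using mm_isometry_measurable[OF X Y mm_isometry_embedding] that by (simp add: measure_preserving_def)
qed

lemma integral_pair_mult:
  fixes f :: "'a \<Rightarrow> real" and g :: "'b \<Rightarrow> real"
  assumes "prob_space M" "prob_space N" and f: "integrable M f" and g: "integrable N g"
  shows "(\<integral>z. f (fst z) * g (snd z) \<partial>(M \<Otimes>\<^sub>M N)) = (\<integral>x. f x \<partial>M) * (\<integral>y. g y \<partial>N)"
    and "integrable (M \<Otimes>\<^sub>M N) (\<lambda>z. f (fst z) * g (snd z))"
proof -
  interpret M: prob_space M by fact
  interpret N: prob_space N by fact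
  interpret P: pair_prob_space M N ..
  have [measurable]: "f \<in> borel_measurable M" "g \<in> borel_measurable N" using f g by auto
  show i: "integrable (M \<Otimes>\<^sub>M N) (\<lambda>z. f (fst z) * g (snd z))"
    by (rule P.Fubini_integrable) (use f g in \<open>auto simp: abs_mult\<close>)
  show "(\<integral>z. f (fst z) * g (snd z) \<partial>(M \<Otimes>\<^sub>M N)) = (\<integral>x. f x \<partial>M) * (\<integral>y. g y \<partial>N)"
    using P.integral_fst'[OF i] by simp
qed

section \<open>Full support and the one-point class\<close>

text \<open>By full support, an almost sure property is not vacuous anywhere: it holds somewhere in each
  nonempty open set. Applied to products of balls in a sum of copies of a space, this turns almost
  sure identities between the distances of independent samples into statements about points that
  can be placed at will.\<close>

lemma mm_space_AE_open:
  assumes X: "mm_space X" and Q: "AE x in snd X. Q x"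
    and U: "openin (mtopology_of (fst X)) U" "U \<noteq> {}"
  shows "\<exists>x\<in>U. Q x"
proof (rule ccontr)
  assume "\<not> ?thesis"
  then have "AE x in snd X. x \<notin> U" using Q by (auto elim: eventually_mono)
  moreover have "U \<in> sets (snd X)"
    using openin_borel_metric[OF U(1)] mm_space_sets[OF X] by simp
  ultimately have "emeasure (snd X) U = 0"
    using AE_iff_measurable[of U "snd X" "\<lambda>x. x \<notin> U"] sets.sets_into_space[of U "snd X"] by auto
  then have "measure (snd X) U = 0" by (simp add: measure_def)
  with X U show False by (cases X) (auto simp: mm_space_def)
qed

lemma openin_sum_metric_Times:
  assumes "openin (mtopology_of m) U" "openin (mtopology_of n) V"
  shows "openin (mtopology_of (sum_metric m n)) (U \<times> V)"
  using assms by (simp add: mtopology_of_sum openin_prod_Times_iff)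

lemma centre_in_mball_of: "x \<in> mspace m \<Longrightarrow> 0 < r \<Longrightarrow> x \<in> mball_of m x r"
  by (metis in_mball_of mdist_zero)

lemma mm_space_nonempty: "mm_space X \<Longrightarrow> mspace (fst X) \<noteq> {}"
  using prob_space.not_empty[OF mm_space_prob, of X] mm_space_space[of X] by simp

lemma mm_class_eqI:
  assumes "mm_space X" "mm_space Y" and "mm_isometry (fst X) (fst Y) \<phi>"
    and "distr (snd X) (snd Y) \<phi> = snd Y"
  shows "mm_class X = mm_class Y"
  using assms by (auto simp: mm_class_eq_iff mm_equiv_def split: prod.splits)

lemma mspace_point: "mspace (fst mm_point) = UNIV" and mdist_point: "mdist (fst mm_point) x y = 0"
proof -
  have M: "Metric_space (UNIV :: unit set) (\<lambda>_ _. 0)" by (simp add: Metric_space_def)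
  show "mspace (fst mm_point) = UNIV" "mdist (fst mm_point) x y = 0"
    unfolding mm_point_def fst_conv Metric_space.mspace_metric[OF M] Metric_space.mdist_metric[OF M]
    by simp_all
qed

lemma mm_class_eq_one_point:
  assumes X: "mm_space X" and singleton: "\<And>x y. x \<in> mspace (fst X) \<Longrightarrow> y \<in> mspace (fst X) \<Longrightarrow> x = y"
  shows "mm_class X = \<E>"
  unfolding one_point_def
proof (rule mm_class_eqI[OF X mm_space_point, of "\<lambda>_. ()"])
  show "mm_isometry (fst X) (fst mm_point) (\<lambda>_. ())"
    using mm_space_nonempty[OF X] singleton mdist_zero
    by (auto simp: mm_isometry_def bij_betw_def inj_on_def mspace_point mdist_point)
  interpret prob_space "snd X" by (rule mm_space_prob[OF X])
  have s: "snd mm_point = return (count_space UNIV) ()" by (simp add: mm_point_def)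
  show "distr (snd X) (snd mm_point) (\<lambda>_. ()) = snd mm_point"
    unfolding s
  proof (rule measure_eqI)
    fix A :: "unit set"
    show "emeasure (distr (snd X) (return (count_space UNIV) ()) (\<lambda>_. ())) A =
        emeasure (return (count_space UNIV) ()) A"
      by (cases "() \<in> A") (auto simp: emeasure_distr emeasure_space_1)
  qed simp
qed

lemma mdist_AE_zero_imp_one_point:
  assumes X: "mm_space X" and ae: "AE z in snd X \<Otimes>\<^sub>M snd X. mdist (fst X) (fst z) (snd z) = 0"
  shows "mm_class X = \<E>"
proof (rule mm_class_eq_one_point[OF X], rule ccontr)
  fix x y assume xy: "x \<in> mspace (fst X)" "y \<in> mspace (fst X)" "x \<noteq> y"
  let ?d = "mdist (fst X)" and ?r = "mdist (fst X) x y / 2"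
  let ?B = "\<lambda>x. mball_of (fst X) x ?r"
  have L: "0 < ?d x y" using xy by (metis mdist_nonneg mdist_zero order_le_less)
  have "\<exists>z\<in>?B x \<times> ?B y. ?d (fst z) (snd z) = 0"
  proof (rule mm_space_AE_open[OF mm_space_sum[OF X X]])
    show "AE z in snd (mm_sum X X). ?d (fst z) (snd z) = 0" using ae unfolding mm_sum_def snd_conv .
    show "openin (mtopology_of (fst (mm_sum X X))) (?B x \<times> ?B y)"
      by (simp add: mm_sum_def openin_sum_metric_Times openin_mball_of)
    show "?B x \<times> ?B y \<noteq> {}"
      using centre_in_mball_of[OF xy(1), of ?r] centre_in_mball_of[OF xy(2), of ?r] L by auto
  qed
  then obtain u v where uv: "u \<in> ?B x" "v \<in> ?B y" "?d u v = 0" by auto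
  have m: "u \<in> mspace (fst X)" "v \<in> mspace (fst X)" using uv by auto
  show False
    using uv mdist_triangle[of x "fst X" u y] mdist_triangle[of u "fst X" v y] xy m
    by (auto simp: mdist_commute)
qed

section \<open>The Laplace transform of the distance between two samples\<close>

lemma mdist_pair_measurable:
  assumes X: "mm_space X"
  shows "(\<lambda>z. mdist (fst X) (fst z) (snd z)) \<in> borel_measurable (snd X \<Otimes>\<^sub>M snd X)"
  unfolding borel_measurable_iff_less
proof
  fix c
  let ?d = "mdist (fst X)" and ?S = "sum_metric (fst X) (fst X)"
  let ?U = "{z \<in> mspace ?S. ?d (fst z) (snd z) < c}"
  have "openin (mtopology_of ?S) ?U"
    unfolding openin_mtopology_of
  proof (intro conjI ballI)
    fix z assume z: "z \<in> ?U"
    show "\<exists>r>0. \<forall>w\<in>mspace ?S. mdist ?S z w < r \<longrightarrow> w \<in> ?U"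
    proof (intro exI[of _ "c - ?d (fst z) (snd z)"] conjI ballI impI)
      fix w assume w: "w \<in> mspace ?S" "mdist ?S z w < c - ?d (fst z) (snd z)"
      have "?d (fst w) (snd w) \<le> ?d (fst z) (fst w) + ?d (fst z) (snd z) + ?d (snd z) (snd w)"
        using mdist_triangle[of "fst w" "fst X" "fst z" "snd w"]
          mdist_triangle[of "fst z" "fst X" "snd z" "snd w"] z w(1) mdist_commute[of "fst X" "fst w" "fst z"]
        by (auto simp: mem_Times_iff)
      then show "w \<in> ?U" using w by (auto simp: split_beta)
    qed (use z in auto)
  qed auto
  then have "?U \<in> sets (snd (mm_sum X X))"
    using openin_borel_metric mm_space_sets[OF mm_space_sum[OF X X]] by (simp add: mm_sum_def)
  then show "{z \<in> space (snd X \<Otimes>\<^sub>M snd X). ?d (fst z) (snd z) < c} \<in> sets (snd X \<Otimes>\<^sub>M snd X)"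
    using mm_space_space[OF X] by (simp add: mm_sum_def space_pair_measure)
qed

lemma mdist_measurable:
  assumes "mm_space X" "f \<in> N \<rightarrow>\<^sub>M snd X" "g \<in> N \<rightarrow>\<^sub>M snd X"
  shows "(\<lambda>x. mdist (fst X) (f x) (g x)) \<in> borel_measurable N"
  using measurable_compose[OF measurable_Pair[OF assms(2,3)] mdist_pair_measurable[OF assms(1)]]
  by simp

text \<open>The Laplace transform of \<open>r(\<xi>,\<eta>)\<close> for independent samples \<open>\<xi>\<close> and \<open>\<eta>\<close>. In a sum of two spaces
  the distance is the sum of two independent distances, so \<open>\<boxplus>\<close> becomes multiplication of numbers.\<close>

definition laplace :: "real \<Rightarrow> 'a mm \<Rightarrow> real" where
  "laplace t X = (\<integral>z. exp (- (t * mdist (fst X) (fst z) (snd z))) \<partial>(snd X \<Otimes>\<^sub>M snd X))"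

lemma mm_space_square_prob: "mm_space X \<Longrightarrow> prob_space (snd X \<Otimes>\<^sub>M snd X)"
  using mm_space_prob[OF mm_space_sum, of X X] by (simp add: mm_sum_def)

lemma laplace_integrable:
  assumes X: "mm_space X" and t: "0 \<le> t"
  shows "integrable (snd X \<Otimes>\<^sub>M snd X) (\<lambda>z. exp (- (t * mdist (fst X) (fst z) (snd z))))"
proof -
  interpret prob_space "snd X \<Otimes>\<^sub>M snd X" by (rule mm_space_square_prob[OF X])
  note [measurable] = mdist_pair_measurable[OF X]
  show ?thesis by (rule integrable_const_bound[of _ 1]) (use t in auto)
qed

lemma laplace_equiv:
  assumes X: "mm_space X" and Y: "mm_space Y" and e: "mm_equiv X Y"
  shows "laplace t X = laplace t Y"
proof -
  obtain \<phi> where \<phi>: "mm_isometry (fst X) (fst Y) \<phi>" and mp: "measure_preserving (snd X) (snd Y) \<phi>"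
    by (rule mm_equiv_measure_preserving[OF X Y e])
  note [measurable] = mdist_pair_measurable[OF Y]
  have "laplace t Y = (\<integral>z. exp (- (t * mdist (fst Y) (fst (map_prod \<phi> \<phi> z)) (snd (map_prod \<phi> \<phi> z)))) \<partial>(snd X \<Otimes>\<^sub>M snd X))"
    unfolding laplace_def
    by (rule measure_preserving_integral[OF measure_preserving_map_prod[OF mp mp mm_space_prob[OF Y]], symmetric])
      measurable
  also have "\<dots> = laplace t X"
    unfolding laplace_def
    using \<phi> mm_space_space[OF X]
    by (intro Bochner_Integration.integral_cong) (auto simp: mm_isometry_def space_pair_measure)
  finally show ?thesis ..
qed

lemma laplace_sum:
  assumes X: "mm_space X" and Y: "mm_space Y" and t: "0 \<le> t"
  shows "laplace t (mm_sum X Y) = laplace t X * laplace t Y"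
proof -
  interpret X: prob_space "snd X" by (rule mm_space_prob[OF X])
  interpret Y: prob_space "snd Y" by (rule mm_space_prob[OF Y])
  interpret XX: pair_prob_space "snd X" "snd X" ..
  interpret YY: pair_prob_space "snd Y" "snd Y" ..
  interpret XY: pair_prob_space "snd X" "snd Y" ..
  interpret P: pair_prob_space "snd X \<Otimes>\<^sub>M snd Y" "snd X \<Otimes>\<^sub>M snd Y" ..
  note [measurable] = mdist_measurable[OF X] mdist_measurable[OF Y]
  define f where "f x x' = exp (- (t * mdist (fst X) x x'))" for x x'
  define g where "g y y' = exp (- (t * mdist (fst Y) y y'))" for y y'
  have b: "0 \<le> f x x'" "f x x' \<le> 1" "0 \<le> g y y'" "g y y' \<le> 1" for x x' y y'
    using t by (auto simp: f_def g_def)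
  have [measurable]: "(\<lambda>z. f (fst z) (snd z)) \<in> borel_measurable (snd X \<Otimes>\<^sub>M snd X)"
    "(\<lambda>z. g (fst z) (snd z)) \<in> borel_measurable (snd Y \<Otimes>\<^sub>M snd Y)"
    unfolding f_def g_def by measurable
  have fi: "integrable (snd X \<Otimes>\<^sub>M snd X) (\<lambda>(x, y). f x y)"
    and gi: "integrable (snd Y \<Otimes>\<^sub>M snd Y) (\<lambda>(x, y). g x y)"
    using laplace_integrable[OF X t] laplace_integrable[OF Y t] by (simp_all add: f_def g_def split_beta')
  have fi': "integrable (snd X) (f x)" if "x \<in> space (snd X)" for x
    unfolding f_def using that
    by (intro X.integrable_const_bound[of _ 1]) (use t in auto)
  have gi': "integrable (snd Y) (g x)" if "x \<in> space (snd Y)" for x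
    unfolding g_def using that
    by (intro Y.integrable_const_bound[of _ 1]) (use t in auto)
  have i: "integrable ((snd X \<Otimes>\<^sub>M snd Y) \<Otimes>\<^sub>M (snd X \<Otimes>\<^sub>M snd Y))
      (\<lambda>(u, v). f (fst u) (fst v) * g (snd u) (snd v))"
  proof (rule P.integrable_const_bound[of _ 1])
    show "AE w in (snd X \<Otimes>\<^sub>M snd Y) \<Otimes>\<^sub>M (snd X \<Otimes>\<^sub>M snd Y).
        norm (case w of (u, v) \<Rightarrow> f (fst u) (fst v) * g (snd u) (snd v)) \<le> 1"
      using b by (auto simp: abs_mult mult_le_one)
    show "(\<lambda>(u, v). f (fst u) (fst v) * g (snd u) (snd v)) \<in> borel_measurable
        ((snd X \<Otimes>\<^sub>M snd Y) \<Otimes>\<^sub>M (snd X \<Otimes>\<^sub>M snd Y))"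
      unfolding f_def g_def split_beta' by measurable
  qed
  have "laplace t (mm_sum X Y) = (\<integral>(u, v). f (fst u) (fst v) * g (snd u) (snd v)
      \<partial>((snd X \<Otimes>\<^sub>M snd Y) \<Otimes>\<^sub>M (snd X \<Otimes>\<^sub>M snd Y)))"
    by (simp add: laplace_def mm_sum_def f_def g_def split_beta' distrib_left flip: exp_add)
  also have "\<dots> = (\<integral>u. \<integral>v. f (fst u) (fst v) * g (snd u) (snd v) \<partial>(snd X \<Otimes>\<^sub>M snd Y) \<partial>(snd X \<Otimes>\<^sub>M snd Y))"
    by (rule P.integral_fst[OF i, symmetric])
  also have "\<dots> = (\<integral>u. (\<integral>x. f (fst u) x \<partial>snd X) * (\<integral>y. g (snd u) y \<partial>snd Y) \<partial>(snd X \<Otimes>\<^sub>M snd Y))"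
    by (intro Bochner_Integration.integral_cong refl integral_pair_mult X.prob_space_axioms Y.prob_space_axioms fi' gi')
      (auto simp: space_pair_measure)
  also have "\<dots> = (\<integral>x. \<integral>x'. f x x' \<partial>snd X \<partial>snd X) * (\<integral>y. \<integral>y'. g y y' \<partial>snd Y \<partial>snd Y)"
    by (intro integral_pair_mult X.prob_space_axioms Y.prob_space_axioms XX.integrable_fst[OF fi] YY.integrable_fst[OF gi])
  also have "\<dots> = laplace t X * laplace t Y"
    unfolding XX.integral_fst[OF fi] YY.integral_fst[OF gi]
    by (simp add: laplace_def f_def g_def split_beta')
  finally show ?thesis .
qed

lemma laplace_scale: "0 < a \<Longrightarrow> laplace t (mm_scale a X) = laplace (t * a) X"
  by (simp add: laplace_def mm_scale_def mult.assoc)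

lemma laplace_pos:
  assumes X: "mm_space X" and t: "0 \<le> t"
  shows "0 < laplace t X"
proof -
  interpret prob_space "snd X \<Otimes>\<^sub>M snd X" by (rule mm_space_square_prob[OF X])
  have "laplace t X \<noteq> 0"
    unfolding laplace_def
    using integral_nonneg_eq_0_iff_AE[OF laplace_integrable[OF X t]] by (simp add: AE_False)
  moreover have "0 \<le> laplace t X" unfolding laplace_def by simp
  ultimately show ?thesis by simp
qed

lemma laplace_antimono:
  assumes X: "mm_space X" and st: "0 \<le> s" "s \<le> t"
  shows "laplace t X \<le> laplace s X"
  unfolding laplace_def
  by (intro integral_mono laplace_integrable X)
    (use st in \<open>auto simp: mult_right_mono\<close>)

lemma laplace_0: "mm_space X \<Longrightarrow> laplace 0 X = 1"
  using prob_space.prob_space[OF mm_space_square_prob] by (simp add: laplace_def)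

lemma laplace_le_1: "mm_space X \<Longrightarrow> 0 \<le> t \<Longrightarrow> laplace t X \<le> 1"
  using laplace_antimono[of X 0 t] by (simp add: laplace_0)

text \<open>The integrand is strictly decreasing in \<open>t\<close> wherever the distance is positive, so a single
  repeated value forces the distance to vanish almost surely.\<close>

lemma laplace_eq_imp_one_point:
  assumes X: "mm_space X" and st: "0 \<le> s" "s < t" and eq: "laplace s X = laplace t X"
  shows "mm_class X = \<E>"
proof (rule mdist_AE_zero_imp_one_point[OF X])
  let ?e = "\<lambda>t z. exp (- (t * mdist (fst X) (fst z) (snd z)))"
  have i: "integrable (snd X \<Otimes>\<^sub>M snd X) (?e s)" "integrable (snd X \<Otimes>\<^sub>M snd X) (?e t)"
    using laplace_integrable[OF X] st by auto
  have "(\<integral>z. ?e s z - ?e t z \<partial>(snd X \<Otimes>\<^sub>M snd X)) = 0"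
    using eq i by (simp add: laplace_def)
  moreover have "0 \<le> ?e s z - ?e t z" for z using st by (simp add: mult_right_mono)
  ultimately have "AE z in snd X \<Otimes>\<^sub>M snd X. ?e s z - ?e t z = 0"
    using integral_nonneg_eq_0_iff_AE[OF Bochner_Integration.integrable_diff[OF i]] by simp
  then show "AE z in snd X \<Otimes>\<^sub>M snd X. mdist (fst X) (fst z) (snd z) = 0"
    by (rule eventually_mono) (use st in auto)
qed

lemma laplace_less_1: "mm_space X \<Longrightarrow> 0 < t \<Longrightarrow> mm_class X \<noteq> \<E> \<Longrightarrow> laplace t X < 1"
  using laplace_le_1[of X t] laplace_eq_imp_one_point[of X 0 t] by (force simp: laplace_0)

lemma laplace_tendsto_1:
  assumes X: "mm_space X"
  shows "(\<lambda>n. laplace (1 / Suc n) X) \<longlonglongrightarrow> 1"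
proof -
  interpret prob_space "snd X \<Otimes>\<^sub>M snd X" by (rule mm_space_square_prob[OF X])
  note [measurable] = mdist_pair_measurable[OF X]
  have "(\<lambda>n. laplace (1 / Suc n) X) \<longlonglongrightarrow> (\<integral>z. 1 \<partial>(snd X \<Otimes>\<^sub>M snd X))"
    unfolding laplace_def
  proof (rule integral_dominated_convergence[where w = "\<lambda>_. 1"])
    show "AE z in snd X \<Otimes>\<^sub>M snd X. (\<lambda>n. exp (- (1 / real (Suc n) * mdist (fst X) (fst z) (snd z)))) \<longlonglongrightarrow> 1"
    proof (rule AE_I2)
      fix z
      have "(\<lambda>n. 1 / real (Suc n)) \<longlonglongrightarrow> 0"
        using LIMSEQ_inverse_real_of_nat by (simp add: inverse_eq_divide)
      then have "(\<lambda>n. exp (- (1 / real (Suc n) * mdist (fst X) (fst z) (snd z)))) \<longlonglongrightarrow> exp (- (0 * mdist (fst X) (fst z) (snd z)))"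
        by (intro tendsto_intros)
      then show "(\<lambda>n. exp (- (1 / real (Suc n) * mdist (fst X) (fst z) (snd z)))) \<longlonglongrightarrow> 1" by simp
    qed
  qed auto
  then show ?thesis by (simp add: prob_space)
qed

text \<open>Two samples fall into the same ball of radius \<open>\<epsilon> / 2\<close> with positive probability, so the transform
  decays more slowly than every exponential. This is where separability excludes a
  deterministic component of the distance.\<close>

lemma laplace_lower_bound:
  assumes X: "mm_space X" and e: "0 < \<epsilon>"
  shows "\<exists>p>0. \<forall>t\<ge>0. p * exp (- (t * \<epsilon>)) \<le> laplace t X"
proof -
  interpret prob_space "snd X \<Otimes>\<^sub>M snd X" by (rule mm_space_square_prob[OF X])
  note [measurable] = mdist_pair_measurable[OF X]
  obtain x where x: "x \<in> mspace (fst X)" using mm_space_nonempty[OF X] by auto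
  let ?d = "mdist (fst X)" and ?B = "mball_of (fst X) x (\<epsilon> / 2)"
  have o: "openin (mtopology_of (fst (mm_sum X X))) (?B \<times> ?B)"
    by (simp add: mm_sum_def openin_sum_metric_Times openin_mball_of)
  have "x \<in> ?B" using x e by (intro centre_in_mball_of) auto
  then have ne: "?B \<times> ?B \<noteq> {}" by blast
  have B: "?B \<times> ?B \<in> sets (snd X \<Otimes>\<^sub>M snd X)"
    using openin_borel_metric[OF o] mm_space_sets[OF mm_space_sum[OF X X]] by (simp add: mm_sum_def)
  have pos: "0 < prob (?B \<times> ?B)"
    using mm_space_sum[OF X X] o ne unfolding mm_space_def mm_sum_def by simp
  have "prob (?B \<times> ?B) * exp (- (t * \<epsilon>)) \<le> laplace t X" if t: "0 \<le> t" for t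
  proof -
    have "prob (?B \<times> ?B) * exp (- (t * \<epsilon>)) = (\<integral>z. exp (- (t * \<epsilon>)) * indicator (?B \<times> ?B) z \<partial>(snd X \<Otimes>\<^sub>M snd X))"
      using B by simp
    also have "\<dots> \<le> laplace t X"
      unfolding laplace_def
    proof (rule integral_mono[OF _ laplace_integrable[OF X t]])
      fix z
      show "exp (- (t * \<epsilon>)) * indicator (?B \<times> ?B) z \<le> exp (- (t * ?d (fst z) (snd z)))"
      proof (cases "z \<in> ?B \<times> ?B")
        case True
        then have "?d (fst z) (snd z) \<le> \<epsilon>"
          using mdist_triangle[of "fst z" "fst X" x "snd z"] x mdist_commute[of "fst X" "fst z" x]
          by (auto simp: mem_Times_iff)
        then show ?thesis using True t by (simp add: mult_left_mono)
      qed simp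
    qed (use B in \<open>simp add: emeasure_eq_measure\<close>)
    finally show ?thesis .
  qed
  with pos show ?thesis by blast
qed

section \<open>The cross difference of four samples\<close>

text \<open>The mixed second difference of the distance. It vanishes identically if the distance has the
  form \<open>D(x) + D(y)\<close>; pairing the first two and the last two points makes its bound in terms of
  \<open>r(x,x')\<close> and \<open>r(y,y')\<close> a function of two independent variables.\<close>

definition cross_diff :: "'a metric \<Rightarrow> ('a \<times> 'a) \<times> ('a \<times> 'a) \<Rightarrow> real" where
  "cross_diff m = (\<lambda>((x, x'), (y, y')). mdist m x y + mdist m x' y' - mdist m x y' - mdist m x' y)"

text \<open>The function \<open>1 - exp (- u)\<close> is bounded, so that integrability is automatic, and subadditive,
  so that \<open>cross_defect s\<close> inherits subadditivity under sums of spaces.\<close>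

definition cross_defect :: "real \<Rightarrow> 'a mm \<Rightarrow> real" where
  "cross_defect s X = (\<integral>z. 1 - exp (- (s * \<bar>cross_diff (fst X) z\<bar>))
     \<partial>((snd X \<Otimes>\<^sub>M snd X) \<Otimes>\<^sub>M (snd X \<Otimes>\<^sub>M snd X)))"

lemma mm_space_fourth_prob:
  "mm_space X \<Longrightarrow> prob_space ((snd X \<Otimes>\<^sub>M snd X) \<Otimes>\<^sub>M (snd X \<Otimes>\<^sub>M snd X))"
  using mm_space_square_prob[OF mm_space_sum, of X X] by (simp add: mm_sum_def)

lemma cross_diff_measurable:
  assumes X: "mm_space X"
  shows "cross_diff (fst X) \<in> borel_measurable ((snd X \<Otimes>\<^sub>M snd X) \<Otimes>\<^sub>M (snd X \<Otimes>\<^sub>M snd X))"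
proof -
  note [measurable] = mdist_measurable[OF X]
  show ?thesis unfolding cross_diff_def split_beta' by measurable
qed

lemma cross_defect_integrable:
  assumes X: "mm_space X" and s: "0 \<le> s"
  shows "integrable ((snd X \<Otimes>\<^sub>M snd X) \<Otimes>\<^sub>M (snd X \<Otimes>\<^sub>M snd X))
    (\<lambda>z. 1 - exp (- (s * \<bar>cross_diff (fst X) z\<bar>)))"
proof -
  interpret prob_space "(snd X \<Otimes>\<^sub>M snd X) \<Otimes>\<^sub>M (snd X \<Otimes>\<^sub>M snd X)" by (rule mm_space_fourth_prob[OF X])
  note [measurable] = cross_diff_measurable[OF X]
  show ?thesis
    by (rule integrable_const_bound[of _ 1]) (use s in auto)
qed

lemma measure_preserving_fourth:
  assumes "measure_preserving M N f" "prob_space N"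
  shows "measure_preserving ((M \<Otimes>\<^sub>M M) \<Otimes>\<^sub>M (M \<Otimes>\<^sub>M M)) ((N \<Otimes>\<^sub>M N) \<Otimes>\<^sub>M (N \<Otimes>\<^sub>M N))
    (map_prod (map_prod f f) (map_prod f f))"
proof -
  interpret prob_space N by fact
  interpret pair_prob_space N N ..
  show ?thesis
    by (intro measure_preserving_map_prod assms prob_space_axioms)
qed

lemma cross_defect_equiv:
  assumes X: "mm_space X" and Y: "mm_space Y" and e: "mm_equiv X Y"
  shows "cross_defect s X = cross_defect s Y"
proof -
  obtain \<phi> where \<phi>: "mm_isometry (fst X) (fst Y) \<phi>" and mp: "measure_preserving (snd X) (snd Y) \<phi>"
    by (rule mm_equiv_measure_preserving[OF X Y e])
  let ?M = "(snd X \<Otimes>\<^sub>M snd X) \<Otimes>\<^sub>M (snd X \<Otimes>\<^sub>M snd X)" and ?\<Phi> = "map_prod (map_prod \<phi> \<phi>) (map_prod \<phi> \<phi>)"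
  note [measurable] = cross_diff_measurable[OF Y]
  have "cross_defect s Y = (\<integral>z. 1 - exp (- (s * \<bar>cross_diff (fst Y) (?\<Phi> z)\<bar>)) \<partial>?M)"
    unfolding cross_defect_def
    by (rule measure_preserving_integral[OF measure_preserving_fourth[OF mp mm_space_prob[OF Y]], symmetric])
      measurable
  also have "\<dots> = cross_defect s X"
    unfolding cross_defect_def
    using \<phi> mm_space_space[OF X]
    by (intro Bochner_Integration.integral_cong)
      (auto simp: mm_isometry_def space_pair_measure cross_diff_def)
  finally show ?thesis ..
qed

lemma cross_defect_scale: "0 < a \<Longrightarrow> cross_defect s (mm_scale a X) = cross_defect (s * a) X"
proof -
  assume a: "0 < a"
  have "\<bar>cross_diff (scale_metric a m) z\<bar> = a * \<bar>cross_diff m z\<bar>" for z :: "('a \<times> 'a) \<times> ('a \<times> 'a)" and m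
  proof -
    have "cross_diff (scale_metric a m) z = a * cross_diff m z"
      using a by (simp add: cross_diff_def split_beta algebra_simps)
    then show ?thesis using a by (simp add: abs_mult)
  qed
  then show ?thesis by (simp add: cross_defect_def mm_scale_def mult.assoc)
qed

lemma one_minus_exp_subadditive:
  fixes u v :: real
  assumes "0 \<le> u" "0 \<le> v"
  shows "1 - exp (- (u + v)) \<le> (1 - exp (- u)) + (1 - exp (- v))"
proof -
  have "0 \<le> (1 - exp (- u)) * (1 - exp (- v))" using assms by (intro mult_nonneg_nonneg) auto
  then show ?thesis by (simp add: algebra_simps flip: exp_add)
qed

lemma cross_defect_sum_le:
  assumes X: "mm_space X" and Y: "mm_space Y" and s: "0 \<le> s"
  shows "cross_defect s (mm_sum X Y) \<le> cross_defect s X + cross_defect s Y"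
proof -
  let ?S = "mm_sum X Y"
  let ?fst = "map_prod (map_prod fst fst) (map_prod fst fst) :: (('a \<times> 'b) \<times> ('a \<times> 'b)) \<times> (('a \<times> 'b) \<times> ('a \<times> 'b)) \<Rightarrow> _"
  let ?snd = "map_prod (map_prod snd snd) (map_prod snd snd) :: (('a \<times> 'b) \<times> ('a \<times> 'b)) \<times> (('a \<times> 'b) \<times> ('a \<times> 'b)) \<Rightarrow> _"
  let ?M = "\<lambda>N. (N \<Otimes>\<^sub>M N) \<Otimes>\<^sub>M (N \<Otimes>\<^sub>M N)"
  let ?g = "\<lambda>m z. 1 - exp (- (s * \<bar>cross_diff m z\<bar>))"
  note pX = mm_space_prob[OF X] and pY = mm_space_prob[OF Y]
  note [measurable] = cross_diff_measurable[OF X] cross_diff_measurable[OF Y]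
  have mp1: "measure_preserving (?M (snd ?S)) (?M (snd X)) ?fst"
    using measure_preserving_fourth[OF measure_preserving_fst[OF pX pY] pX] by (simp add: mm_sum_def)
  have mp2: "measure_preserving (?M (snd ?S)) (?M (snd Y)) ?snd"
    using measure_preserving_fourth[OF measure_preserving_snd[OF pX pY] pY] by (simp add: mm_sum_def)
  have b1: "?g (fst X) \<in> borel_measurable (?M (snd X))" by measurable
  have b2: "?g (fst Y) \<in> borel_measurable (?M (snd Y))" by measurable
  have i1: "integrable (?M (snd ?S)) (\<lambda>z. ?g (fst X) (?fst z))"
    using integrable_distr[of ?fst "?M (snd ?S)" "?M (snd X)"] cross_defect_integrable[OF X s] mp1
    by (simp add: measure_preserving_def)
  have i2: "integrable (?M (snd ?S)) (\<lambda>z. ?g (fst Y) (?snd z))"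
    using integrable_distr[of ?snd "?M (snd ?S)" "?M (snd Y)"] cross_defect_integrable[OF Y s] mp2
    by (simp add: measure_preserving_def)
  have "cross_defect s ?S \<le> (\<integral>z. ?g (fst X) (?fst z) + ?g (fst Y) (?snd z) \<partial>?M (snd ?S))"
    unfolding cross_defect_def
  proof (rule integral_mono[OF cross_defect_integrable[OF mm_space_sum[OF X Y] s] Bochner_Integration.integrable_add[OF i1 i2]])
    fix z
    have "cross_diff (fst ?S) z = cross_diff (fst X) (?fst z) + cross_diff (fst Y) (?snd z)"
      by (simp add: cross_diff_def mm_sum_def split_beta)
    then have "s * \<bar>cross_diff (fst ?S) z\<bar> \<le> s * \<bar>cross_diff (fst X) (?fst z)\<bar> + s * \<bar>cross_diff (fst Y) (?snd z)\<bar>"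
      using mult_left_mono[OF abs_triangle_ineq s] by (simp add: distrib_left)
    then have "?g (fst ?S) z \<le> 1 - exp (- (s * \<bar>cross_diff (fst X) (?fst z)\<bar> + s * \<bar>cross_diff (fst Y) (?snd z)\<bar>))"
      by simp
    also have "\<dots> \<le> ?g (fst X) (?fst z) + ?g (fst Y) (?snd z)"
      by (rule one_minus_exp_subadditive) (use s in auto)
    finally show "?g (fst ?S) z \<le> ?g (fst X) (?fst z) + ?g (fst Y) (?snd z)" .
  qed
  also have "\<dots> = cross_defect s X + cross_defect s Y"
    unfolding Bochner_Integration.integral_add[OF i1 i2]
    using measure_preserving_integral[OF mp1 b1] measure_preserving_integral[OF mp2 b2]
    by (simp add: cross_defect_def)
  finally show ?thesis .
qed

text \<open>If one of the variables is at least \<open>1 / t\<close>, the product controls the minimum. If both are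
  smaller, \<open>u\<close> is at most \<open>(2 / t) (1 - exp (- t u))\<close>.\<close>

lemma one_minus_exp_min_le:
  fixes t u v :: real
  assumes t: "0 < t" and uv: "0 \<le> u" "0 \<le> v"
  shows "1 - exp (- (2 * min u v)) \<le>
    (1 - exp (- (2 * u))) * (1 - exp (- (2 * v))) / (1 - exp (- (2 / t))) + 4 / t * (1 - exp (- (t * u)))"
proof -
  let ?A = "\<lambda>u. 1 - exp (- (2 * u)) :: real"
  have c: "0 < ?A (1 / t)" using t by simp
  have mono: "?A u \<le> ?A v" if "u \<le> v" for u v using that by simp
  have nn: "0 \<le> ?A u" "0 \<le> ?A v" "0 \<le> 4 / t * (1 - exp (- (t * u)))" using uv t by auto
  show ?thesis
  proof (cases "1 / t \<le> max u v")
    case True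
    have "?A (min u v) * ?A (1 / t) \<le> ?A (min u v) * ?A (max u v)"
      using mono[OF True] uv by (intro mult_left_mono) auto
    also have "\<dots> = ?A u * ?A v" by (simp add: min_def max_def)
    finally have "?A (min u v) \<le> ?A u * ?A v / ?A (1 / t)" using c by (simp add: pos_le_divide_eq)
    with nn(3) show ?thesis by simp
  next
    case False
    define w where "w = t * u"
    have "u < 1 / t" using False by simp
    then have w: "0 \<le> w" "w \<le> 1" using t uv by (auto simp: w_def field_simps)
    have "w / 2 \<le> 1 - exp (- w)"
    proof -
      have "exp (- w) * (1 + w) \<le> 1"
        using mult_left_mono[OF exp_ge_add_one_self[of w], of "exp (- w)"] by (simp flip: exp_add)
      then have "exp (- w) \<le> 1 / (1 + w)" using w by (simp add: field_simps)
      also have "\<dots> \<le> 1 - w / 2"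
      proof -
        have "w * w \<le> w * 1" using w by (intro mult_left_mono) auto
        then show ?thesis using w by (simp add: field_simps)
      qed
      finally show ?thesis by simp
    qed
    then have "2 * u \<le> 4 / t * (1 - exp (- (t * u)))"
      using t by (simp add: w_def field_simps)
    moreover have "?A (min u v) \<le> 2 * u"
      using mono[of "min u v" u] exp_ge_add_one_self[of "- (2 * u)"] by linarith
    moreover have "0 \<le> ?A u * ?A v / ?A (1 / t)" using nn c by simp
    ultimately show ?thesis by simp
  qed
qed

text \<open>Moving \<open>x\<close> to \<open>x'\<close> changes each of two distances by at most \<open>r(x,x')\<close>; likewise for \<open>y\<close> and \<open>y'\<close>.\<close>

lemma cross_diff_le:
  assumes "x \<in> mspace m" "x' \<in> mspace m" "y \<in> mspace m" "y' \<in> mspace m"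
  shows "\<bar>cross_diff m ((x, x'), (y, y'))\<bar> \<le> 2 * min (mdist m x x') (mdist m y y')"
  using assms mdist_triangle[of x m x' y] mdist_triangle[of x' m x y]
    mdist_triangle[of x m x' y'] mdist_triangle[of x' m x y']
    mdist_triangle[of x m y y'] mdist_triangle[of x m y' y]
    mdist_triangle[of x' m y y'] mdist_triangle[of x' m y' y]
    mdist_commute[of m x x'] mdist_commute[of m y y']
  by (simp add: cross_diff_def abs_le_iff min_def)

text \<open>The independence of \<open>r(x,x')\<close> and \<open>r(y,y')\<close> turns the product in \<open>one_minus_exp_min_le\<close> into a
  square, which is negligible compared with \<open>1 - laplace (2 * s) X\<close> when \<open>s\<close> is small. The second
  term is not negligible in this sense, but its factor \<open>1 / t\<close> remains when the estimates for many
  independent parts are added.\<close>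

lemma cross_defect_le:
  assumes X: "mm_space X" and s: "0 \<le> s" and t: "0 < t"
  shows "cross_defect s X \<le> (1 - laplace (2 * s) X)\<^sup>2 / (1 - exp (- (2 / t))) + 4 / t * (1 - laplace (t * s) X)"
proof -
  let ?P = "snd X \<Otimes>\<^sub>M snd X" and ?d = "\<lambda>p. mdist (fst X) (fst p) (snd p)"
  note P = mm_space_square_prob[OF X]
  interpret P: prob_space ?P by (rule P)
  note [measurable] = cross_diff_measurable[OF X] mdist_pair_measurable[OF X]
  define A where "A r p = 1 - exp (- (r * ?d p))" for r p
  have Ai: "integrable ?P (A r)" if "0 \<le> r" for r
    unfolding A_def using laplace_integrable[OF X that] by simp
  have AI: "integral\<^sup>L ?P (A r) = 1 - laplace r X" if "0 \<le> r" for r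
    unfolding A_def laplace_def using laplace_integrable[OF X that] P.prob_space by simp
  let ?C = "1 - exp (- (2 / t))"
  note s2 = mult_nonneg_nonneg[OF zero_le_numeral s, of "num.Bit0 num.One"]
  have ts: "0 \<le> t * s" using s t by simp
  note prod = integral_pair_mult[OF P P Ai[OF s2] Ai[OF s2]]
  have fst: "measure_preserving (?P \<Otimes>\<^sub>M ?P) ?P fst" by (rule measure_preserving_fst[OF P P])
  have i1: "integrable (?P \<Otimes>\<^sub>M ?P) (\<lambda>z. A (t * s) (fst z))"
    using integrable_distr[of fst "?P \<Otimes>\<^sub>M ?P" ?P "A (t * s)"] fst Ai[OF ts]
    by (simp add: measure_preserving_def)
  have I1: "(\<integral>z. A (t * s) (fst z) \<partial>(?P \<Otimes>\<^sub>M ?P)) = 1 - laplace (t * s) X"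
    using measure_preserving_integral[OF fst, of "A (t * s)"] AI[OF ts] Ai[OF ts] by simp
  have "cross_defect s X \<le> (\<integral>z. A (2 * s) (fst z) * A (2 * s) (snd z) / ?C + 4 / t * A (t * s) (fst z) \<partial>(?P \<Otimes>\<^sub>M ?P))"
    unfolding cross_defect_def
  proof (rule integral_mono[OF cross_defect_integrable[OF X s]])
    show "integrable (?P \<Otimes>\<^sub>M ?P) (\<lambda>z. A (2 * s) (fst z) * A (2 * s) (snd z) / ?C + 4 / t * A (t * s) (fst z))"
      using prod(2) i1 by (intro Bochner_Integration.integrable_add) auto
    fix z assume "z \<in> space (?P \<Otimes>\<^sub>M ?P)"
    then obtain x x' y y' where z: "z = ((x, x'), (y, y'))" and
      m: "x \<in> mspace (fst X)" "x' \<in> mspace (fst X)" "y \<in> mspace (fst X)" "y' \<in> mspace (fst X)"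
      by (auto simp: space_pair_measure mm_space_space[OF X])
    let ?u = "s * mdist (fst X) x x'" and ?v = "s * mdist (fst X) y y'"
    have "s * \<bar>cross_diff (fst X) z\<bar> \<le> s * (2 * min (mdist (fst X) x x') (mdist (fst X) y y'))"
      unfolding z by (rule mult_left_mono[OF cross_diff_le[OF m] s])
    also have "\<dots> = 2 * min ?u ?v" using s by (simp add: min_mult_distrib_left)
    finally have "1 - exp (- (s * \<bar>cross_diff (fst X) z\<bar>)) \<le> 1 - exp (- (2 * min ?u ?v))" by simp
    also have "\<dots> \<le> (1 - exp (- (2 * ?u))) * (1 - exp (- (2 * ?v))) / ?C + 4 / t * (1 - exp (- (t * ?u)))"
      by (rule one_minus_exp_min_le[OF t]) (use s in auto)
    finally show "1 - exp (- (s * \<bar>cross_diff (fst X) z\<bar>)) \<le>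
        A (2 * s) (fst z) * A (2 * s) (snd z) / ?C + 4 / t * A (t * s) (fst z)"
      by (simp add: A_def z mult.assoc)
  qed
  also have "\<dots> = (1 - laplace (2 * s) X)\<^sup>2 / ?C + 4 / t * (1 - laplace (t * s) X)"
    using prod i1 I1 AI[OF s2] by (simp add: power2_eq_square)
  finally show ?thesis .
qed

text \<open>If \<open>x \<noteq> y\<close>, full support yields points \<open>u, v\<close> near \<open>x\<close> and \<open>u', v'\<close> near \<open>y\<close> with vanishing cross
  difference. But \<open>r(u,v) + r(u',v')\<close> is near \<open>0\<close> while \<open>r(u,v') + r(u',v)\<close> is near \<open>2 r(x,y)\<close>; with
  radius \<open>r(x,y) / 8\<close> the two sides are less than \<open>r(x,y) / 2\<close> and more than \<open>3 r(x,y) / 2\<close>.\<close>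

lemma cross_defect_eq_0_imp_one_point:
  assumes X: "mm_space X" and 0: "cross_defect 1 X \<le> 0"
  shows "mm_class X = \<E>"
proof (rule mm_class_eq_one_point[OF X], rule ccontr)
  fix x y assume xy: "x \<in> mspace (fst X)" "y \<in> mspace (fst X)" "x \<noteq> y"
  let ?d = "mdist (fst X)" and ?XX = "mm_sum X X" and ?r = "mdist (fst X) x y / 8"
  let ?B = "\<lambda>x. mball_of (fst X) x ?r"
  let ?U = "(?B x \<times> ?B y) \<times> (?B x \<times> ?B y)"
  have L: "0 < ?d x y" using xy by (metis mdist_nonneg mdist_zero order_le_less)
  let ?g = "\<lambda>z. 1 - exp (- (1 * \<bar>cross_diff (fst X) z\<bar>))"
  let ?M = "(snd X \<Otimes>\<^sub>M snd X) \<Otimes>\<^sub>M (snd X \<Otimes>\<^sub>M snd X)"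
  have "0 \<le> cross_defect 1 X" unfolding cross_defect_def by (rule integral_nonneg_AE) auto
  with 0 have "cross_defect 1 X = 0" by simp
  then have "AE z in ?M. ?g z = 0"
    using integral_nonneg_eq_0_iff_AE[OF cross_defect_integrable[OF X, of 1]] by (simp add: cross_defect_def)
  then have ae: "AE z in snd (mm_sum ?XX ?XX). cross_diff (fst X) z = 0"
    unfolding mm_sum_def snd_conv fst_conv by (rule eventually_mono) simp
  have "\<exists>z\<in>?U. cross_diff (fst X) z = 0"
  proof (rule mm_space_AE_open[OF mm_space_sum[OF mm_space_sum[OF X X] mm_space_sum[OF X X]] ae])
    show "openin (mtopology_of (fst (mm_sum ?XX ?XX))) ?U"
      by (simp add: mm_sum_def openin_sum_metric_Times openin_mball_of)
    show "?U \<noteq> {}"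
      using centre_in_mball_of[OF xy(1), of ?r] centre_in_mball_of[OF xy(2), of ?r] L by auto
  qed
  then obtain u u' v v' where uv: "u \<in> ?B x" "u' \<in> ?B y" "v \<in> ?B x" "v' \<in> ?B y"
    and eq: "?d u v + ?d u' v' = ?d u v' + ?d u' v"
    by (auto simp: cross_diff_def)
  have m: "u \<in> mspace (fst X)" "u' \<in> mspace (fst X)" "v \<in> mspace (fst X)" "v' \<in> mspace (fst X)"
    and lt: "?d x u < ?r" "?d y u' < ?r" "?d x v < ?r" "?d y v' < ?r" using uv by auto
  note tri = mdist_triangle[of _ "fst X"] and com = mdist_commute[of "fst X"]
  have "?d u v < 2 * ?r" using tri[OF m(1) xy(1) m(3)] lt com[of u x] by simp
  moreover have "?d u' v' < 2 * ?r" using tri[OF m(2) xy(2) m(4)] lt com[of u' y] by simp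
  moreover have "?d x y < ?d u v' + 2 * ?r"
    using tri[OF xy(1) m(1) xy(2)] tri[OF m(1) m(4) xy(2)] lt com[of v' y] by simp
  moreover have "?d x y < ?d u' v + 2 * ?r"
    using tri[OF xy(1) m(3) xy(2)] tri[OF m(3) m(2) xy(2)] lt com[of u' y] com[of v u'] by simp
  ultimately show False using eq L by simp
qed

section \<open>Spaces that are sums of two scaled copies of themselves\<close>

text \<open>Splitting a copy of scale \<open>s\<close> repeatedly into copies of scales \<open>s p\<close> and \<open>s q\<close> makes all scales as
  small as desired. Since \<open>g\<close> is additive and \<open>H\<close> subadditive under splitting, a bound for small
  scales propagates to all scales.\<close>

lemma self_similar_bound:
  fixes f H g :: "real \<Rightarrow> real"
  assumes p: "0 < p" "p < 1" and q: "0 < q" "q < 1"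
    and g: "\<And>s. 0 < s \<Longrightarrow> g s = g (s * p) + g (s * q)"
    and H: "\<And>s. 0 < s \<Longrightarrow> H s \<le> H (s * p) + H (s * q)"
    and s0: "0 < s0" and small: "\<And>s. 0 < s \<Longrightarrow> s \<le> s0 \<Longrightarrow> H s \<le> g s"
    and s: "0 < s"
  shows "H s \<le> g s"
proof -
  define M where "M = max p q"
  have M: "0 < M" "M < 1" "p \<le> M" "q \<le> M" using p q by (auto simp: M_def)
  have ind: "H s \<le> g s" if "0 < s" "s * M ^ n \<le> s0" for n s
    using that
  proof (induction n arbitrary: s)
    case 0
    then show ?case using small by simp
  next
    case (Suc n)
    have le: "s * r * M ^ n \<le> s0" if "r \<le> M" "0 < r" for r
    proof -
      have "s * r * M ^ n \<le> s * M * M ^ n"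
        using that Suc.prems M by (intro mult_right_mono mult_left_mono) auto
      also have "\<dots> \<le> s0" using Suc.prems by (simp add: mult.assoc)
      finally show ?thesis .
    qed
    have "H s \<le> H (s * p) + H (s * q)" using H Suc.prems by simp
    also have "\<dots> \<le> g (s * p) + g (s * q)"
      using p q M Suc.prems by (intro add_mono Suc.IH le) auto
    also have "\<dots> = g s" using g Suc.prems by simp
    finally show ?case .
  qed
  obtain n where "M ^ n < s0 / s" using real_arch_pow_inv[of "s0 / s" M] s s0 M by auto
  then have "s * M ^ n \<le> s0" using s by (simp add: field_simps)
  then show ?thesis by (rule ind[OF s])
qed

lemma neg_ln_laplace_small:
  assumes X: "mm_space X" and e: "0 < \<epsilon>"
  shows "\<exists>s0>0. \<forall>s. 0 < s \<longrightarrow> s \<le> s0 \<longrightarrow> - ln (laplace s X) \<le> \<epsilon>"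
proof -
  have "\<forall>\<^sub>F n in sequentially. exp (- \<epsilon>) < laplace (1 / Suc n) X"
    by (rule order_tendstoD[OF laplace_tendsto_1[OF X]]) (use e in simp)
  then obtain n where n: "exp (- \<epsilon>) < laplace (1 / Suc n) X" by (auto simp: eventually_sequentially)
  have "- ln (laplace s X) \<le> \<epsilon>" if "0 < s" "s \<le> 1 / Suc n" for s
  proof -
    have "exp (- \<epsilon>) \<le> laplace s X" using n laplace_antimono[OF X _ that(2)] that by simp
    then have "- \<epsilon> \<le> ln (laplace s X)" using laplace_pos[OF X, of s] that by (simp add: ln_ge_iff)
    then show ?thesis by simp
  qed
  then show ?thesis by (intro exI[of _ "1 / Suc n"]) auto
qed

lemma neg_ln_laplace_sublinear:
  assumes X: "mm_space X" and e: "0 < \<epsilon>"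
  shows "\<exists>t>0. - ln (laplace t X) \<le> \<epsilon> * t"
proof -
  obtain p where p: "0 < p" and le: "\<And>t. 0 \<le> t \<Longrightarrow> p * exp (- (t * (\<epsilon> / 2))) \<le> laplace t X"
    using laplace_lower_bound[OF X, of "\<epsilon> / 2"] e by auto
  define t where "t = 2 / \<epsilon> * (\<bar>ln p\<bar> + 1)"
  have t: "0 < t" using e by (simp add: t_def add_nonneg_pos)
  have "ln p - t * (\<epsilon> / 2) = ln (p * exp (- (t * (\<epsilon> / 2))))" using p by (simp add: ln_mult)
  also have "\<dots> \<le> ln (laplace t X)" using le[of t] t p by (intro ln_mono) auto
  finally have "- ln (laplace t X) \<le> t * (\<epsilon> / 2) - ln p" by simp
  also have "\<dots> \<le> t * (\<epsilon> / 2) + t * (\<epsilon> / 2)"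
  proof -
    have "t * (\<epsilon> / 2) = \<bar>ln p\<bar> + 1" using e by (simp add: t_def)
    then show ?thesis by linarith
  qed
  also have "\<dots> = \<epsilon> * t" by simp
  finally show ?thesis using t by blast
qed

text \<open>Write \<open>f(s) = - ln (laplace s X)\<close>, which is additive under the splitting, and let \<open>H(s)\<close> be the
  cross defect at scale \<open>s\<close>, which is subadditive. By \<open>cross_defect_le\<close>, \<open>H(s)\<close> is at most
  \<open>C\<^sub>t f(2 s)\<^sup>2 + (4 / t) f(t s)\<close>, and for small \<open>s\<close> one factor \<open>f(2 s)\<close> absorbs the constant \<open>C\<^sub>t\<close>. So
  \<open>H(1) \<le> \<eta> f(2) + (4 / t) f(t)\<close> for each \<open>\<eta> > 0\<close>, and \<open>f(t) / t\<close> can be made small as well.\<close>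

lemma self_similar_one_point:
  assumes X: "mm_space X" and p: "0 < p" "p < 1" and q: "0 < q" "q < 1"
    and e: "mm_equiv X (mm_sum (mm_scale p X) (mm_scale q X))"
  shows "mm_class X = \<E>"
proof (rule cross_defect_eq_0_imp_one_point[OF X], rule field_le_epsilon)
  fix \<epsilon> :: real assume \<epsilon>: "0 < \<epsilon>"
  let ?f = "\<lambda>s. - ln (laplace s X)"
  note sp = mm_space_scale[OF p(1) X] mm_space_scale[OF q(1) X]
  have f: "?f s = ?f (s * p) + ?f (s * q)" if s: "0 < s" for s
    using laplace_equiv[OF X mm_space_sum[OF sp] e, of s] laplace_sum[OF sp, of s]
      laplace_scale[OF p(1), of s X] laplace_scale[OF q(1), of s X]
      laplace_pos[OF X, of "s * p"] laplace_pos[OF X, of "s * q"] s p q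
    by (simp add: ln_mult)
  have H: "cross_defect s X \<le> cross_defect (s * p) X + cross_defect (s * q) X" if s: "0 < s" for s
    using cross_defect_equiv[OF X mm_space_sum[OF sp] e, of s] cross_defect_sum_le[OF sp, of s]
      cross_defect_scale[OF p(1), of s X] cross_defect_scale[OF q(1), of s X] s by simp
  have f0: "0 \<le> ?f s" "1 - laplace s X \<le> ?f s" if "0 \<le> s" for s
    using laplace_pos[OF X that] laplace_le_1[OF X that] ln_le_minus_one[of "laplace s X"] by simp_all
  obtain t where t: "0 < t" "?f t \<le> \<epsilon> / 8 * t" using neg_ln_laplace_sublinear[OF X, of "\<epsilon> / 8"] \<epsilon> by auto
  let ?C = "1 - exp (- (2 / t))"
  have C: "0 < ?C" using t by simp
  \<comment> \<open>The summand \<open>1\<close> keeps the denominator positive in case \<open>?f 2 = 0\<close>.\<close>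
  define \<eta> where "\<eta> = \<epsilon> / (2 * (?f 2 + 1))"
  have \<eta>: "0 < \<eta>" "\<eta> * ?f 2 \<le> \<epsilon> / 2" using \<epsilon> f0(1)[of 2] by (auto simp: \<eta>_def field_simps)
  obtain s0 where s0: "0 < s0" "\<And>s. 0 < s \<Longrightarrow> s \<le> s0 \<Longrightarrow> ?f s \<le> \<eta> * ?C"
    using neg_ln_laplace_small[OF X mult_pos_pos[OF \<eta>(1) C]] by blast
  define g where "g s = \<eta> * ?f (2 * s) + 4 / t * ?f (t * s)" for s
  have "cross_defect 1 X \<le> g 1"
  proof (rule self_similar_bound[where H = "\<lambda>s. cross_defect s X" and g = g and s = 1, OF p q])
    show "g s = g (s * p) + g (s * q)" if "0 < s" for s
    proof -
      have "g s = \<eta> * (?f (2 * s * p) + ?f (2 * s * q)) + 4 / t * (?f (t * s * p) + ?f (t * s * q))"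
        unfolding g_def using f[of "2 * s"] f[of "t * s"] that t(1) by simp
      also have "\<dots> = g (s * p) + g (s * q)"
        unfolding g_def mult.assoc distrib_left by simp
      finally show ?thesis .
    qed
    show "cross_defect s X \<le> cross_defect (s * p) X + cross_defect (s * q) X" if "0 < s" for s by (rule H[OF that])
    \<comment> \<open>The bound of \<open>cross_defect_le\<close> uses \<open>f\<close> at \<open>2 * s\<close>, hence the factor \<open>1 / 2\<close>.\<close>
    show "0 < s0 / 2" using s0 by simp
    show "cross_defect s X \<le> g s" if s: "0 < s" "s \<le> s0 / 2" for s
    proof -
      let ?L = "1 - laplace (2 * s) X"
      have L: "0 \<le> ?L" "?L \<le> ?f (2 * s)" using f0[of "2 * s"] laplace_le_1[OF X, of "2 * s"] s by simp_all
      have "?L\<^sup>2 \<le> ?f (2 * s) * ?f (2 * s)"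
        unfolding power2_eq_square using L by (intro mult_mono) auto
      also have "\<dots> \<le> \<eta> * ?C * ?f (2 * s)"
        using s0(2)[of "2 * s"] s f0(1)[of "2 * s"] by (intro mult_right_mono) auto
      finally have 1: "?L\<^sup>2 / ?C \<le> \<eta> * ?f (2 * s)" using C by (simp add: field_simps)
      have "1 - laplace (t * s) X \<le> ?f (t * s)" using f0(2) s t by simp
      then have 2: "4 / t * (1 - laplace (t * s) X) \<le> 4 / t * ?f (t * s)"
        using t by (intro mult_left_mono) auto
      show ?thesis
        using cross_defect_le[OF X _ t(1), of s] s 1 2 by (simp add: g_def)
    qed
  qed simp
  also have "g 1 \<le> \<epsilon> / 2 + \<epsilon> / 2"
  proof -
    have "4 / t * ?f t \<le> 4 / t * (\<epsilon> / 8 * t)" using t by (intro mult_left_mono) auto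
    then show ?thesis using \<eta>(2) t(1) by (simp add: g_def)
  qed
  finally show "cross_defect 1 X \<le> 0 + \<epsilon>" by simp
qed

section \<open>Algebraic laws of sums and scalings\<close>

lemma mm_class_exhaust:
  obtains X :: "real mm" where "mm_space X" "\<X> = mm_class X"
  using mm_space_rep mm_class_rep[symmetric] by blast

lemma boxplus_commute: "\<Y> \<boxplus> \<Z> = \<Z> \<boxplus> \<Y>"
proof -
  obtain Y :: "real mm" where Y: "mm_space Y" "\<Y> = mm_class Y" by (rule mm_class_exhaust)
  obtain Z :: "real mm" where Z: "mm_space Z" "\<Z> = mm_class Z" by (rule mm_class_exhaust)
  interpret Y: prob_space "snd Y" by (rule mm_space_prob[OF Y(1)])
  interpret Z: prob_space "snd Z" by (rule mm_space_prob[OF Z(1)])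
  interpret P: pair_prob_space "snd Z" "snd Y" ..
  have "mm_class (mm_sum Y Z) = mm_class (mm_sum Z Y)"
  proof (rule mm_class_eqI[of _ _ prod.swap])
    show "mm_isometry (fst (mm_sum Y Z)) (fst (mm_sum Z Y)) prod.swap"
      by (auto simp: mm_isometry_def mm_sum_def bij_betw_def)
    show "distr (snd (mm_sum Y Z)) (snd (mm_sum Z Y)) prod.swap = snd (mm_sum Z Y)"
      using P.distr_pair_swap by (simp add: mm_sum_def prod.swap_def[abs_def] split_beta')
  qed (simp_all add: mm_space_sum Y Z)
  then show ?thesis by (simp add: Y Z boxplus_mm_class)
qed

lemma distr_pair_assoc:
  assumes "prob_space L" "prob_space M" "prob_space N"
  shows "distr ((L \<Otimes>\<^sub>M M) \<Otimes>\<^sub>M N) (L \<Otimes>\<^sub>M (M \<Otimes>\<^sub>M N)) (\<lambda>z. (fst (fst z), snd (fst z), snd z)) =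
    L \<Otimes>\<^sub>M (M \<Otimes>\<^sub>M N)"
proof (rule measure_eqI)
  interpret L: prob_space L by fact
  interpret M: prob_space M by fact
  interpret N: prob_space N by fact
  interpret LM: pair_prob_space L M ..
  interpret MN: pair_prob_space M N ..
  fix A assume "A \<in> sets (distr ((L \<Otimes>\<^sub>M M) \<Otimes>\<^sub>M N) (L \<Otimes>\<^sub>M (M \<Otimes>\<^sub>M N)) (\<lambda>z. (fst (fst z), snd (fst z), snd z)))"
  then have A[measurable]: "A \<in> sets (L \<Otimes>\<^sub>M (M \<Otimes>\<^sub>M N))" by simp
  have i[measurable]: "(\<lambda>z. indicator A (fst (fst z), snd (fst z), snd z) :: ennreal)
      \<in> borel_measurable ((L \<Otimes>\<^sub>M M) \<Otimes>\<^sub>M N)"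
    by measurable
  have "emeasure (distr ((L \<Otimes>\<^sub>M M) \<Otimes>\<^sub>M N) (L \<Otimes>\<^sub>M (M \<Otimes>\<^sub>M N)) (\<lambda>z. (fst (fst z), snd (fst z), snd z))) A
      = (\<integral>\<^sup>+z. indicator A z \<partial>distr ((L \<Otimes>\<^sub>M M) \<Otimes>\<^sub>M N) (L \<Otimes>\<^sub>M (M \<Otimes>\<^sub>M N)) (\<lambda>z. (fst (fst z), snd (fst z), snd z)))"
    by simp
  also have "\<dots> = (\<integral>\<^sup>+z. indicator A (fst (fst z), snd (fst z), snd z) \<partial>((L \<Otimes>\<^sub>M M) \<Otimes>\<^sub>M N))"
    by (rule nn_integral_distr) measurable
  also have "\<dots> = (\<integral>\<^sup>+u. \<integral>\<^sup>+z. indicator A (fst u, snd u, z) \<partial>N \<partial>(L \<Otimes>\<^sub>M M))"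
    using N.nn_integral_fst[OF i] by simp
  also have "\<dots> = (\<integral>\<^sup>+x. \<integral>\<^sup>+y. \<integral>\<^sup>+z. indicator A (x, y, z) \<partial>N \<partial>M \<partial>L)"
    by (subst M.nn_integral_fst[symmetric]) simp_all
  also have "\<dots> = (\<integral>\<^sup>+x. \<integral>\<^sup>+v. indicator A (x, v) \<partial>(M \<Otimes>\<^sub>M N) \<partial>L)"
    by (intro nn_integral_cong) (subst N.nn_integral_fst[symmetric], simp_all)
  also have "\<dots> = (\<integral>\<^sup>+w. indicator A w \<partial>(L \<Otimes>\<^sub>M (M \<Otimes>\<^sub>M N)))"
    by (rule MN.nn_integral_fst) simp
  also have "\<dots> = emeasure (L \<Otimes>\<^sub>M (M \<Otimes>\<^sub>M N)) A" by simp
  finally show "emeasure (distr ((L \<Otimes>\<^sub>M M) \<Otimes>\<^sub>M N) (L \<Otimes>\<^sub>M (M \<Otimes>\<^sub>M N)) (\<lambda>z. (fst (fst z), snd (fst z), snd z))) A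
      = emeasure (L \<Otimes>\<^sub>M (M \<Otimes>\<^sub>M N)) A" .
qed simp

lemma boxplus_assoc: "(\<X> \<boxplus> \<Y>) \<boxplus> \<Z> = \<X> \<boxplus> (\<Y> \<boxplus> \<Z>)"
proof -
  obtain X :: "real mm" where X: "mm_space X" "\<X> = mm_class X" by (rule mm_class_exhaust)
  obtain Y :: "real mm" where Y: "mm_space Y" "\<Y> = mm_class Y" by (rule mm_class_exhaust)
  obtain Z :: "real mm" where Z: "mm_space Z" "\<Z> = mm_class Z" by (rule mm_class_exhaust)
  let ?f = "\<lambda>z. (fst (fst z), snd (fst z), snd z)"
  have "mm_class (mm_sum (mm_sum X Y) Z) = mm_class (mm_sum X (mm_sum Y Z))"
  proof (rule mm_class_eqI[of _ _ ?f])
    show "mm_isometry (fst (mm_sum (mm_sum X Y) Z)) (fst (mm_sum X (mm_sum Y Z))) ?f"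
      by (auto simp: mm_isometry_def mm_sum_def bij_betw_def inj_on_def image_iff)
    show "distr (snd (mm_sum (mm_sum X Y) Z)) (snd (mm_sum X (mm_sum Y Z))) ?f = snd (mm_sum X (mm_sum Y Z))"
      using distr_pair_assoc[of "snd X" "snd Y" "snd Z"] X Y Z by (simp add: mm_sum_def mm_space_prob)
  qed (simp_all add: mm_space_sum X Y Z)
  then show ?thesis by (simp add: X Y Z boxplus_mm_class mm_space_sum)
qed

lemma boxplus_one_point: "\<X> \<boxplus> \<E> = \<X>"
proof -
  obtain X :: "real mm" where X: "mm_space X" "\<X> = mm_class X" by (rule mm_class_exhaust)
  have "mm_class (mm_sum X mm_point) = mm_class X"
  proof (rule mm_class_eqI[of _ _ fst])
    show "mm_isometry (fst (mm_sum X mm_point)) (fst X) fst"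
      by (auto simp: mm_isometry_def mm_sum_def bij_betw_def inj_on_def mspace_point mdist_point)
    show "distr (snd (mm_sum X mm_point)) (snd X) fst = snd X"
      using measure_preserving_fst[OF mm_space_prob[OF X(1)] mm_space_prob[OF mm_space_point]]
      by (simp add: mm_sum_def measure_preserving_def)
  qed (simp_all add: mm_space_sum X mm_space_point)
  then show ?thesis by (simp add: X one_point_def boxplus_mm_class mm_space_point)
qed

lemma scale_boxplus:
  assumes a: "0 < a"
  shows "a \<odot> (\<Y> \<boxplus> \<Z>) = (a \<odot> \<Y>) \<boxplus> (a \<odot> \<Z>)"
proof -
  obtain Y :: "real mm" where Y: "mm_space Y" "\<Y> = mm_class Y" by (rule mm_class_exhaust)
  obtain Z :: "real mm" where Z: "mm_space Z" "\<Z> = mm_class Z" by (rule mm_class_exhaust)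
  have "mm_class (mm_scale a (mm_sum Y Z)) = mm_class (mm_sum (mm_scale a Y) (mm_scale a Z))"
  proof (rule mm_class_eqI[of _ _ "\<lambda>z. z"])
    show "mm_isometry (fst (mm_scale a (mm_sum Y Z))) (fst (mm_sum (mm_scale a Y) (mm_scale a Z))) (\<lambda>z. z)"
      using a by (auto simp: mm_isometry_def mm_sum_def mm_scale_def bij_betw_def distrib_left)
    show "distr (snd (mm_scale a (mm_sum Y Z))) (snd (mm_sum (mm_scale a Y) (mm_scale a Z))) (\<lambda>z. z)
        = snd (mm_sum (mm_scale a Y) (mm_scale a Z))"
      by (simp add: mm_sum_def mm_scale_def distr_id)
  qed (simp_all add: mm_space_sum mm_space_scale a Y Z)
  then show ?thesis by (simp add: Y Z a boxplus_mm_class scale_mm_class mm_space_sum mm_space_scale)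
qed

lemma scale_scale:
  assumes "0 < a" "0 < b"
  shows "a \<odot> b \<odot> \<X> = (a * b) \<odot> \<X>"
proof -
  obtain X :: "real mm" where X: "mm_space X" "\<X> = mm_class X" by (rule mm_class_exhaust)
  have "mm_class (mm_scale a (mm_scale b X)) = mm_class (mm_scale (a * b) X)"
  proof (rule mm_class_eqI[of _ _ "\<lambda>z. z"])
    show "mm_isometry (fst (mm_scale a (mm_scale b X))) (fst (mm_scale (a * b) X)) (\<lambda>z. z)"
      using assms by (auto simp: mm_isometry_def mm_scale_def bij_betw_def)
    show "distr (snd (mm_scale a (mm_scale b X))) (snd (mm_scale (a * b) X)) (\<lambda>z. z) = snd (mm_scale (a * b) X)"
      by (simp add: mm_scale_def distr_id)
  qed (simp_all add: mm_space_scale assms X)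
  then show ?thesis by (simp add: X assms scale_mm_class mm_space_scale)
qed

lemma scale_1: "1 \<odot> \<X> = \<X>"
proof -
  obtain X :: "real mm" where X: "mm_space X" "\<X> = mm_class X" by (rule mm_class_exhaust)
  have "mm_class (mm_scale 1 X) = mm_class X"
  proof (rule mm_class_eqI[of _ _ "\<lambda>z. z"])
    show "mm_isometry (fst (mm_scale 1 X)) (fst X) (\<lambda>z. z)"
      by (auto simp: mm_isometry_def mm_scale_def bij_betw_def)
    show "distr (snd (mm_scale 1 X)) (snd X) (\<lambda>z. z) = snd X"
      by (simp add: mm_scale_def distr_id)
  qed (simp_all add: mm_space_scale X)
  then show ?thesis by (simp add: X scale_mm_class)
qed

lemma laplace_rep_mmc_class: "mm_space X \<Longrightarrow> laplace t (rep_mmc (mm_class X)) = laplace t X"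
  by (rule laplace_equiv[symmetric]) (simp_all add: mm_space_rep rep_mm_class)

lemma laplace_boxplus:
  "0 \<le> t \<Longrightarrow> laplace t (rep_mmc (\<Y> \<boxplus> \<Z>)) = laplace t (rep_mmc \<Y>) * laplace t (rep_mmc \<Z>)"
  unfolding boxplus_def by (simp add: laplace_rep_mmc_class mm_space_sum mm_space_rep laplace_sum)

lemma laplace_scale_class:
  "0 < a \<Longrightarrow> laplace t (rep_mmc (a \<odot> \<X>)) = laplace (t * a) (rep_mmc \<X>)"
  unfolding scale_def by (simp add: laplace_rep_mmc_class mm_space_scale mm_space_rep laplace_scale)

text \<open>Adding a summand cannot increase the Laplace transform, whereas scaling by \<open>a < 1\<close> strictly increases
  that of a space with more than one point.\<close>

lemma le_scale_imp_one_le: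
  assumes a: "0 < a" and le: "\<X> \<preceq> a \<odot> \<X>" and ne: "\<X> \<noteq> \<E>"
  shows "1 \<le> a"
proof (rule ccontr)
  assume "\<not> 1 \<le> a"
  obtain \<W> where W: "a \<odot> \<X> = \<X> \<boxplus> \<W>" using le by (auto simp: mmc_le_def)
  let ?X = "rep_mmc \<X>"
  note sp = mm_space_rep[of \<X>]
  have "laplace a ?X = laplace 1 ?X * laplace 1 (rep_mmc \<W>)"
    using W laplace_boxplus[of 1 \<X> \<W>] laplace_scale_class[OF a, of 1 \<X>] by simp
  also have "\<dots> \<le> laplace 1 ?X"
    using laplace_le_1[OF mm_space_rep, of 1 \<W>] laplace_pos[OF sp, of 1] by (simp add: mult_left_le)
  finally have "laplace a ?X = laplace 1 ?X"
    using laplace_antimono[OF sp, of a 1] a \<open>\<not> 1 \<le> a\<close> by simp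
  then show False
    using laplace_eq_imp_one_point[OF sp, of a 1] a ne \<open>\<not> 1 \<le> a\<close> by simp
qed

section \<open>Small summands in the Gromov-Prohorov metric\<close>

lemma isometric_embedding_fst_slice:
  "z \<in> mspace n \<Longrightarrow> isometric_embedding m (sum_metric m n) (\<lambda>x. (x, z))"
  and isometric_embedding_snd_slice:
  "x \<in> mspace m \<Longrightarrow> isometric_embedding n (sum_metric m n) (\<lambda>z. (x, z))"
  using mdist_zero by (auto simp: isometric_embedding_def)

text \<open>An infimum over the empty set of reals is unspecified, so it has to be shown that both spaces
  embed into a common metric space with real carrier: a copy of their sum will do.\<close>

lemma gromov_prohorov_nonneg:
  assumes X: "mm_space X" and Y: "mm_space Y"
  shows "0 \<le> gromov_prohorov X Y"
  unfolding gromov_prohorov_def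
proof (rule cInf_greatest)
  obtain x where x: "x \<in> mspace (fst X)" using mm_space_nonempty[OF X] by auto
  obtain y where y: "y \<in> mspace (fst Y)" using mm_space_nonempty[OF Y] by auto
  obtain S :: "real mm" where "mm_equiv (mm_sum X Y) S"
    using mm_real_copy[OF mm_space_sum[OF X Y]] by blast
  then obtain \<phi> where "mm_isometry (fst (mm_sum X Y)) (fst S) \<phi>"
    by (auto simp: mm_equiv_def split: prod.splits)
  then have "isometric_embedding (sum_metric (fst X) (fst Y)) (fst S) \<phi>"
    using mm_isometry_embedding by (auto simp: mm_sum_def)
  note isometric_embedding_comp[OF isometric_embedding_fst_slice[OF y] this]
    isometric_embedding_comp[OF isometric_embedding_snd_slice[OF x] this]
  then show "{embedded_prohorov X Y m \<phi> \<psi> | (m :: real metric) \<phi> \<psi>.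
      isometric_embedding (fst X) m \<phi> \<and> isometric_embedding (fst Y) m \<psi>} \<noteq> {}"
    by blast
qed (use embedded_prohorov_nonneg[OF X] in blast)

text \<open>Embed \<open>S\<close> into the sum as the slice through \<open>w\<close>. A point \<open>(s, w)\<close> of a closed set \<open>F\<close> can be moved
  to \<open>(s, y)\<close> for each \<open>y\<close> in the ball around \<open>w\<close> without leaving the neighbourhood of \<open>F\<close>.\<close>

lemma gromov_prohorov_sum_le:
  assumes S: "mm_space S" and W: "mm_space W" and w: "w \<in> mspace (fst W)" and \<epsilon>: "0 < \<epsilon>"
    and B: "1 - \<epsilon> \<le> measure (snd W) (mball_of (fst W) w \<epsilon>)"
  shows "gromov_prohorov S (mm_sum S W) \<le> \<epsilon>"
proof -
  let ?m = "sum_metric (fst S) (fst W)" and ?\<phi> = "\<lambda>s. (s, w)" and ?\<psi> = "\<lambda>z. z"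
  note SW = mm_space_sum[OF S W]
  interpret S: prob_space "snd S" by (rule mm_space_prob[OF S])
  interpret W: prob_space "snd W" by (rule mm_space_prob[OF W])
  interpret SW: pair_prob_space "snd S" "snd W" ..
  have fst: "fst (mm_sum S W) = ?m" by (simp add: mm_sum_def)
  have \<phi>: "isometric_embedding (fst S) ?m ?\<phi>" by (rule isometric_embedding_fst_slice[OF w])
  have \<psi>: "isometric_embedding (fst (mm_sum S W)) ?m ?\<psi>" by (auto simp: isometric_embedding_def fst)
  let ?mS = "distr (snd S) (borel_metric ?m) ?\<phi>" and ?mSW = "distr (snd (mm_sum S W)) (borel_metric ?m) ?\<psi>"
  have main: "measure ?mS F \<le> measure ?mSW (nhd_of ?m F \<epsilon>) + \<epsilon>" if F: "closedin (mtopology_of ?m) F" for F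
  proof -
    let ?A = "?\<phi> -` F \<inter> space (snd S)" and ?B = "mball_of (fst W) w \<epsilon>"
    have Fm: "F \<subseteq> mspace ?m" using closedin_subset[OF F] by simp
    have A: "?A \<in> sets (snd S)"
      by (rule measurable_sets[OF embedding_measurable[OF S \<phi>] closedin_borel_metric[OF F]])
    have Bs: "?B \<in> sets (snd W)"
      using openin_borel_metric[OF openin_mball_of] mm_space_sets[OF W] by simp
    have N: "nhd_of ?m F \<epsilon> \<in> sets (snd S \<Otimes>\<^sub>M snd W)"
      using openin_borel_metric[OF openin_nhd_of[OF Fm]] mm_space_sets[OF SW]
      by (simp add: mm_sum_def)
    have "measure ?mS F = measure (snd S) ?A"
      by (rule measure_distr[OF embedding_measurable[OF S \<phi>] closedin_borel_metric[OF F]])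
    also have "\<dots> \<le> measure (snd S) ?A * measure (snd W) ?B + \<epsilon>"
    proof -
      have "measure (snd S) ?A * (1 - measure (snd W) ?B) \<le> 1 * (1 - measure (snd W) ?B)"
        by (intro mult_right_mono) auto
      then show ?thesis using B by (simp add: algebra_simps)
    qed
    also have "measure (snd S) ?A * measure (snd W) ?B = measure (snd S \<Otimes>\<^sub>M snd W) (?A \<times> ?B)"
      using A Bs by (simp add: measure_def W.emeasure_pair_measure_Times enn2real_mult)
    also have "\<dots> \<le> measure (snd S \<Otimes>\<^sub>M snd W) (nhd_of ?m F \<epsilon>)"
    proof (rule SW.finite_measure_mono[OF _ N], rule subsetI)
      fix z assume z: "z \<in> ?A \<times> ?B"
      obtain x y where xy: "z = (x, y)" by fastforce
      with z have h: "(x, w) \<in> F" "x \<in> mspace (fst S)" "y \<in> mspace (fst W)" "mdist (fst W) y w < \<epsilon>"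
        using mdist_commute[of "fst W" w y] by (auto simp: mm_space_space[OF S])
      moreover have "mdist (fst S) x x + mdist (fst W) y w < \<epsilon>"
        using h(2,4) by (metis add_0 mdist_zero)
      ultimately show "z \<in> nhd_of ?m F \<epsilon>"
        unfolding nhd_of_def xy by (auto intro!: bexI[of _ "(x, w)"])
    qed
    also have "measure (snd S \<Otimes>\<^sub>M snd W) (nhd_of ?m F \<epsilon>) = measure ?mSW (nhd_of ?m F \<epsilon>)"
    proof -
      have "nhd_of ?m F \<epsilon> \<subseteq> space (snd S \<Otimes>\<^sub>M snd W)" using sets.sets_into_space[OF N] .
      then have "?\<psi> -` nhd_of ?m F \<epsilon> \<inter> space (snd (mm_sum S W)) = nhd_of ?m F \<epsilon>"
        by (auto simp: mm_sum_def)
      then show ?thesis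
        using measure_distr[OF embedding_measurable[OF SW \<psi>] openin_borel_metric[OF openin_nhd_of[OF Fm, of \<epsilon>]]]
        by (simp add: mm_sum_def)
    qed
    finally show ?thesis by simp
  qed
  have "gromov_prohorov S (mm_sum S W) \<le> embedded_prohorov S (mm_sum S W) ?m ?\<phi> ?\<psi>"
    by (rule gromov_prohorov_le[OF S SW \<phi> \<psi>])
  also have "\<dots> \<le> \<epsilon>"
    unfolding embedded_prohorov_def prohorov_def
  proof (rule cInf_lower)
    show "\<epsilon> \<in> {\<epsilon>. 0 < \<epsilon> \<and> (\<forall>F. closedin (mtopology_of ?m) F \<longrightarrow> measure ?mS F \<le> measure ?mSW (nhd_of ?m F \<epsilon>) + \<epsilon>)}"
      using main \<epsilon> by blast
  qed (auto intro!: bdd_belowI[of _ 0])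
  finally show ?thesis .
qed

lemma measure_large_ball:
  assumes W: "mm_space W" and w: "w \<in> mspace (fst W)" and \<epsilon>: "0 < \<epsilon>"
  shows "\<exists>R. \<forall>r\<ge>R. 1 - \<epsilon> \<le> measure (snd W) (mball_of (fst W) w r)"
proof -
  interpret prob_space "snd W" by (rule mm_space_prob[OF W])
  let ?B = "\<lambda>r. mball_of (fst W) w r"
  have Bs: "?B r \<in> sets (snd W)" for r
    using openin_borel_metric[OF openin_mball_of] mm_space_sets[OF W] by simp
  have "(\<lambda>n. prob (?B (real n))) \<longlonglongrightarrow> prob (\<Union>n. ?B (real n))"
    using w by (intro finite_Lim_measure_incseq) (auto simp: Bs incseq_def intro: order_less_le_trans)
  moreover have "(\<Union>n. ?B (real n)) = space (snd W)"
    using w reals_Archimedean2 by (auto simp: mm_space_space[OF W])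
  ultimately have "(\<lambda>n. prob (?B (real n))) \<longlonglongrightarrow> 1" by (simp add: prob_space)
  then have "\<forall>\<^sub>F n in sequentially. 1 - \<epsilon> < prob (?B (real n))"
    by (rule order_tendstoD) (use \<epsilon> in simp)
  then obtain n where n: "1 - \<epsilon> < prob (?B (real n))" by (auto simp: eventually_sequentially)
  have "prob (?B (real n)) \<le> prob (?B r)" if "real n \<le> r" for r
    using that by (intro finite_measure_mono Bs) auto
  with n show ?thesis by (meson less_le_trans order_less_imp_le)
qed

text \<open>All but \<open>\<epsilon>\<close> of the mass lies in some ball around a fixed point, and scaling by \<open>s n\<close> shrinks the
  radius of that ball below \<open>\<epsilon>\<close>. The estimate does not involve \<open>\<S> n\<close>.\<close>

lemma d_GPr_boxplus_scale_tendsto: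
  assumes s: "\<And>n. 0 < s n" and lim: "s \<longlonglongrightarrow> 0"
  shows "(\<lambda>n. d_GPr (\<S> n) (\<S> n \<boxplus> (s n \<odot> \<X>))) \<longlonglongrightarrow> 0"
proof (rule LIMSEQ_I)
  fix r :: real assume r: "0 < r"
  let ?X = "rep_mmc \<X>"
  define \<epsilon> where "\<epsilon> = r / 2"
  have \<epsilon>: "0 < \<epsilon>" using r by (simp add: \<epsilon>_def)
  note X = mm_space_rep[of \<X>]
  obtain w where w: "w \<in> mspace (fst ?X)" using mm_space_nonempty[OF X] by auto
  obtain R where R: "\<And>r. R \<le> r \<Longrightarrow> 1 - \<epsilon> \<le> measure (snd ?X) (mball_of (fst ?X) w r)"
    using measure_large_ball[OF X w \<epsilon>] by blast
  have "\<forall>\<^sub>F n in sequentially. s n < \<epsilon> / (\<bar>R\<bar> + 1)"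
    by (rule order_tendstoD[OF lim]) (use \<epsilon> in simp)
  then obtain N where N: "\<And>n. N \<le> n \<Longrightarrow> s n < \<epsilon> / (\<bar>R\<bar> + 1)" by (auto simp: eventually_sequentially)
  show "\<exists>N. \<forall>n\<ge>N. norm (d_GPr (\<S> n) (\<S> n \<boxplus> (s n \<odot> \<X>)) - 0) < r"
  proof (intro exI[of _ N] allI impI)
    fix n assume "N \<le> n"
    then have "s n * (\<bar>R\<bar> + 1) < \<epsilon>" using N by (simp add: field_simps)
    moreover have "s n * R \<le> s n * (\<bar>R\<bar> + 1)" using s[of n] by (intro mult_left_mono) auto
    ultimately have "R \<le> \<epsilon> / s n" using s by (simp add: field_simps)
    moreover have "mball_of (fst (mm_scale (s n) ?X)) w \<epsilon> = mball_of (fst ?X) w (\<epsilon> / s n)"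
      using s[of n] by (auto simp: mm_scale_def field_simps)
    ultimately have B: "1 - \<epsilon> \<le> measure (snd (mm_scale (s n) ?X)) (mball_of (fst (mm_scale (s n) ?X)) w \<epsilon>)"
      using R by (simp add: mm_scale_def)
    let ?S = "rep_mmc (\<S> n)" and ?W = "mm_scale (s n) ?X"
    have S: "mm_space ?S" and W: "mm_space ?W" using s by (simp_all add: mm_space_rep mm_space_scale)
    have "\<S> n \<boxplus> (s n \<odot> \<X>) = mm_class (mm_sum ?S ?W)"
      using boxplus_mm_class[OF S W] by (simp add: scale_def)
    then have eq: "d_GPr (\<S> n) (\<S> n \<boxplus> (s n \<odot> \<X>)) = gromov_prohorov ?S (mm_sum ?S ?W)"
      using d_GPr_mm_class[OF S mm_space_sum[OF S W]] by simp
    have "w \<in> mspace (fst ?W)" using w s by (simp add: mm_scale_def)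
    then have "gromov_prohorov ?S (mm_sum ?S ?W) \<le> \<epsilon>"
      by (rule gromov_prohorov_sum_le[OF S W _ \<epsilon> B])
    moreover have "0 \<le> gromov_prohorov ?S (mm_sum ?S ?W)"
      by (rule gromov_prohorov_nonneg[OF S mm_space_sum[OF S W]])
    ultimately show "norm (d_GPr (\<S> n) (\<S> n \<boxplus> (s n \<odot> \<X>)) - 0) < r"
      using eq r by (simp add: \<epsilon>_def)
  qed
qed

text \<open>Scaling \<open>a \<odot> \<X> = \<X> \<boxplus> \<Z>\<close> by \<open>a\<^sup>-\<^sup>n\<^sup>-\<^sup>1\<close> replaces the remainder of scale \<open>a\<^sup>-\<^sup>n\<close> by the next summand
  and the next remainder.\<close>

lemma boxplus_upto_remainder:
  assumes a: "0 < a" and Z: "a \<odot> \<X> = \<X> \<boxplus> \<Z>"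
  shows "\<X> = boxplus_upto (\<lambda>k. a powi (- int k) \<odot> \<Z>) n \<boxplus> (a powi (- int n) \<odot> \<X>)"
proof (induction n)
  case 0
  then show ?case by (simp add: scale_1 boxplus_commute[of \<E>] boxplus_one_point)
next
  case (Suc n)
  let ?p = "\<lambda>k. a powi (- int k)" and ?S = "boxplus_upto (\<lambda>k. a powi (- int k) \<odot> \<Z>)"
  have p: "0 < ?p k" for k using a by simp
  have q: "?p n = ?p (Suc n) * a" using a by (simp add: power_int_minus power_inverse field_simps del: of_nat_Suc)
  have "?p n \<odot> \<X> = ?p (Suc n) \<odot> (a \<odot> \<X>)"
    using scale_scale[OF p[of "Suc n"] a] q by simp
  also have "\<dots> = (?p (Suc n) \<odot> \<X>) \<boxplus> (?p (Suc n) \<odot> \<Z>)"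
    unfolding Z by (rule scale_boxplus[OF p])
  finally have "\<X> = ?S n \<boxplus> ((?p (Suc n) \<odot> \<X>) \<boxplus> (?p (Suc n) \<odot> \<Z>))"
    using Suc.IH by simp
  also have "\<dots> = ?S (Suc n) \<boxplus> (?p (Suc n) \<odot> \<X>)"
    unfolding boxplus_upto.simps boxplus_assoc
    by (subst boxplus_commute[of "?p (Suc n) \<odot> \<X>"]) (rule refl)
  finally show ?case .
qed

lemma scale_one_point: "0 < a \<Longrightarrow> a \<odot> \<E> = \<E>"
  unfolding one_point_def
  by (subst scale_mm_class) (auto simp: mm_space_point mm_space_scale one_point_def[symmetric] intro!: mm_class_eq_one_point)

section \<open>Self-similar spaces and their series\<close>

lemma boxplus_scale_self_imp_one_point:
  assumes p: "0 < p" and q: "0 < q" and eq: "\<X> = (p \<odot> \<X>) \<boxplus> (q \<odot> \<X>)"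
  shows "\<X> = \<E>"
proof (rule ccontr)
  assume ne: "\<X> \<noteq> \<E>"
  let ?X = "rep_mmc \<X>"
  note sp = mm_space_rep[of \<X>]
  note spq = mm_space_scale[OF p sp] mm_space_scale[OF q sp]
  have L: "laplace 1 ?X = laplace p ?X * laplace q ?X"
    using laplace_boxplus[of 1 "p \<odot> \<X>" "q \<odot> \<X>"] eq
      laplace_scale_class[OF p, of 1 \<X>] laplace_scale_class[OF q, of 1 \<X>] by simp
  have pq: "0 < laplace r ?X" "laplace r ?X < 1" if "0 < r" for r
    using laplace_pos[OF sp, of r] laplace_less_1[OF sp that] ne that by simp_all
  have "laplace 1 ?X < laplace p ?X" "laplace 1 ?X < laplace q ?X"
    using L pq[OF p] pq[OF q] by simp_all
  then have lt: "p < 1" "q < 1"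
    using laplace_antimono[OF sp, of 1 p] laplace_antimono[OF sp, of 1 q] by force+
  have "mm_class ?X = mm_class (mm_sum (mm_scale p ?X) (mm_scale q ?X))"
    using eq boxplus_mm_class[OF spq] by (simp add: scale_def)
  then have "mm_equiv ?X (mm_sum (mm_scale p ?X) (mm_scale q ?X))"
    using mm_class_eq_iff[OF sp mm_space_sum[OF spq]] by simp
  then have "mm_class ?X = \<E>"
    by (rule self_similar_one_point[OF sp p lt(1) q lt(2)])
  then show False using ne by simp
qed

lemma boxplus_sums_of_scale:
  assumes a: "0 < a" "a \<noteq> 1" and Z: "a \<odot> \<X> = \<X> \<boxplus> \<Z>"
  shows "boxplus_sums (\<lambda>k. a powi (- int k) \<odot> \<Z>) \<X>"
proof -
  let ?S = "boxplus_upto (\<lambda>k. a powi (- int k) \<odot> \<Z>)"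
  obtain s where s: "\<And>n. 0 < s n" "s \<longlonglongrightarrow> 0" and eq: "\<And>n. \<X> = ?S n \<boxplus> (s n \<odot> \<X>)"
  proof (cases "\<X> = \<E>")
    case True
    \<comment> \<open>Here \<open>a < 1\<close> is possible, so that the scales \<open>a\<^sup>-\<^sup>n\<close> grow. Scaling does nothing to
      the one-point class, so any null sequence can be used instead.\<close>
    have "(\<lambda>n. 1 / real (Suc n)) \<longlonglongrightarrow> 0"
      using LIMSEQ_inverse_real_of_nat by (simp add: inverse_eq_divide)
    moreover have "\<X> = ?S n \<boxplus> ((1 / real (Suc n)) \<odot> \<X>)" for n
      using boxplus_upto_remainder[OF a(1) Z, of n] a(1) by (simp add: True scale_one_point)
    ultimately show ?thesis by (intro that[of "\<lambda>n. 1 / real (Suc n)"]) auto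
  next
    case False
    have "1 < a" using le_scale_imp_one_le[OF a(1) _ False] Z a(2) by (force simp: mmc_le_def)
    then have "(\<lambda>n. (1 / a) ^ n) \<longlonglongrightarrow> 0" by (intro LIMSEQ_power_zero) simp
    then have "(\<lambda>n. a powi (- int n)) \<longlonglongrightarrow> 0"
      by (simp add: power_int_minus power_one_over inverse_eq_divide)
    then show ?thesis
      using boxplus_upto_remainder[OF a(1) Z] a(1) by (intro that[of "\<lambda>n. a powi (- int n)"]) auto
  qed
  have "(\<lambda>n. d_GPr (?S n) (?S n \<boxplus> (s n \<odot> \<X>))) \<longlonglongrightarrow> 0"
    by (rule d_GPr_boxplus_scale_tendsto[OF s])
  then show ?thesis unfolding boxplus_sums_def using eq by simp
qed

theorem proposition7p2:
  fixes \<X> :: mmc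
  shows "(\<forall>a::real. 0 < a \<and> a \<noteq> 1 \<and> \<X> \<preceq> a \<odot> \<X> \<longrightarrow>
            (\<X> \<noteq> \<E> \<longrightarrow> 1 < a) \<and>
            (\<forall>\<Z>. a \<odot> \<X> = \<X> \<boxplus> \<Z> \<longrightarrow> boxplus_sums (\<lambda>k. a powi (- int k) \<odot> \<Z>) \<X>)) \<and>
         (\<forall>a b c::real. 0 < a \<and> 0 < b \<and> 0 < c \<and> (a \<odot> \<X>) \<boxplus> (b \<odot> \<X>) = c \<odot> \<X> \<longrightarrow> \<X> = \<E>)"
proof (intro conjI allI impI)
  fix a :: real
  assume a: "0 < a \<and> a \<noteq> 1 \<and> \<X> \<preceq> a \<odot> \<X>"
  then show "1 < a" if "\<X> \<noteq> \<E>" using le_scale_imp_one_le[of a \<X>] that by force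
  fix \<Z> assume "a \<odot> \<X> = \<X> \<boxplus> \<Z>"
  then show "boxplus_sums (\<lambda>k. a powi (- int k) \<odot> \<Z>) \<X>" using a boxplus_sums_of_scale by blast
next
  fix a b c :: real
  assume abc: "0 < a \<and> 0 < b \<and> 0 < c \<and> (a \<odot> \<X>) \<boxplus> (b \<odot> \<X>) = c \<odot> \<X>"
  then have c: "0 < inverse c" by simp
  have "\<X> = inverse c \<odot> c \<odot> \<X>" using scale_scale[OF c, of c \<X>] abc by (simp add: scale_1)
  also have "\<dots> = inverse c \<odot> ((a \<odot> \<X>) \<boxplus> (b \<odot> \<X>))" using abc by simp
  also have "\<dots> = ((inverse c * a) \<odot> \<X>) \<boxplus> ((inverse c * b) \<odot> \<X>)"
    unfolding scale_boxplus[OF c] using scale_scale[OF c] abc by metis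
  finally show "\<X> = \<E>"
    by (rule boxplus_scale_self_imp_one_point[rotated 2]) (use abc in auto)
qed

end
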